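(* Let $(W,S)$ be a Coxeter system of rank three (that is, $|S|=3$) and let $c\in W$ be a Coxeter element. The three maps (1) $[1,c]_T \to \mathrm{Sub}(V)$, $x\mapsto \mathsf{AM}(x)$; (2) $[1,c]_T \to \mathrm{RS}(W)$, $x\mapsto P(x)$; (3) $[1,c]_T \to \mathcal{P}(T)$, $x\mapsto T(x)$ are isomorphisms of posets onto their images.
   Context: $T=\bigcup_{w\in W} wSw^{-1}$ is the set of reflections of $W$. The reflection length $\ell_T(w)$ is the smallest $k\ge 0$ such that $w$ is a product of $k$ elements of $T$. The absolute order is the partial order on $W$ defined by $u\leq_T v \iff \ell_T(u)+\ell_T(u^{-1}v)=\ell_T(v)$. A Coxeter element is a product of all the elements of $S$, each occurring exactly once, in some order. $[1,c]_T=\{x\in W\mid x\leq_T c\}$, ordered by $\leq_T$. $V$ is the geometric representation of $W$: the real vector space with basis $\{\alpha_s\}_{s\in S}$, with symmetric bilinear form $B$ given by $B(\alpha_s,\alpha_{s'})=-\cos(\pi/m_{ss'})$ (equal to $-1$ if $m_{ss'}=\infty$), on which $s\in S$ acts by $s(v)=v-2B(\alpha_s,v)\alpha_s$. The root system is $\Phi=\{w(\alpha_s)\mid w\in W, s\in S\}=\Phi^+\sqcup\Phi^-$; for $t\in T$, $\alpha_t\in\Phi^+$ denotes the unique positive root such that $t(v)=v-2B(\alpha_t,v)\alpha_t$ for all $v \in V$. For $x\in[1,c]_T$: $T(x)=\{t\in T\mid t\leq_T x\}$; $P(x)$ is the subgroup of $W$ generated by $T(x)$; and $\mathsf{AM}(x)=\sum_{t\in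 T(x)}\mathbb{R}\alpha_t\subseteq V$ (the absolute moved space of $x$). $\mathrm{Sub}(V)$ is the set of linear subspaces of $V$; $\mathrm{RS}(W)$ is the set of reflection subgroups of $W$, i.e. subgroups generated by a subset of $T$; $\mathcal{P}(T)$ is the set of subsets of $T$. All three are partially ordered by inclusion. A map $f$ between posets is an isomorphism of posets onto its image if it is injective and $x\leq y\iff f(x)\leq f(y)$ for all $x,y$. *)

theory Defs
  imports
    "HOL-Algebra.Multiplicative_Group"
    "HOL-Algebra.Generated_Groups"
    "HOL-Analysis.Finite_Function_Topology"
begin

section \<open>Coxeter systems\<close>

definition list_prod :: "('a, 'b) monoid_scheme \<Rightarrow> 'a list \<Rightarrow> 'a" where
  "list_prod W ws = foldr (\<lambda>x y. x \<otimes>\<^bsub>W\<^esub> y) ws \<one>\<^bsub>W\<^esub>"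

(* m(s,t) is the order of s t in W; the value 0 stands for infinity, as in group.ord *)
definition cox_m :: "('a, 'b) monoid_scheme \<Rightarrow> 'a \<Rightarrow> 'a \<Rightarrow> nat" where
  "cox_m W s t = group.ord W (s \<otimes>\<^bsub>W\<^esub> t)"

(* The congruence on words over S generated by the relations (s t)^m(s,t) = 1. The relators
   with s = t are the words s s, so the quotient monoid is a group in which every generator is
   its own inverse, and formal inverses of the letters are not needed. For m(s,t) = 0 (infinite
   order) the relator is the empty word, so there is no relation. *)
inductive cox_equiv :: "('a, 'b) monoid_scheme \<Rightarrow> 'a set \<Rightarrow> 'a list \<Rightarrow> 'a list \<Rightarrow> bool"
  for W S where
  relator: "\<lbrakk>s \<in> S; t \<in> S; us \<in> lists S; vs \<in> lists S\<rbrakk> \<Longrightarrow>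
      cox_equiv W S (us @ concat (replicate (cox_m W s t) [s, t]) @ vs) (us @ vs)"
| refl: "us \<in> lists S \<Longrightarrow> cox_equiv W S us us"
| sym: "cox_equiv W S us vs \<Longrightarrow> cox_equiv W S vs us"
| trans: "\<lbrakk>cox_equiv W S us vs; cox_equiv W S vs ws\<rbrakk> \<Longrightarrow> cox_equiv W S us ws"

(* (W,S) is a Coxeter system in the sense of Bourbaki: S consists of elements of order 2 and
   W = < S | (s t)^m(s,t) = 1 whenever m(s,t) is finite >, m(s,t) being the order of s t. *)
definition coxeter_system :: "('a, 'b) monoid_scheme \<Rightarrow> 'a set \<Rightarrow> bool" where
  "coxeter_system W S \<longleftrightarrow>
     group W \<and> S \<subseteq> carrier W \<and> generate W S = carrier W \<and>
     (\<forall>s\<in>S. group.ord W s = 2) \<and>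
     (\<forall>us\<in>lists S. \<forall>vs\<in>lists S. list_prod W us = list_prod W vs \<longrightarrow> cox_equiv W S us vs)"

definition coxeter_element :: "('a, 'b) monoid_scheme \<Rightarrow> 'a set \<Rightarrow> 'a \<Rightarrow> bool" where
  "coxeter_element W S c \<longleftrightarrow> (\<exists>ss. distinct ss \<and> set ss = S \<and> list_prod W ss = c)"


section \<open>Reflections and the absolute order\<close>

definition reflections :: "('a, 'b) monoid_scheme \<Rightarrow> 'a set \<Rightarrow> 'a set" where
  "reflections W S = {w \<otimes>\<^bsub>W\<^esub> s \<otimes>\<^bsub>W\<^esub> inv\<^bsub>W\<^esub> w | w s. w \<in> carrier W \<and> s \<in> S}"

definition refl_length :: "('a, 'b) monoid_scheme \<Rightarrow> 'a set \<Rightarrow> 'a \<Rightarrow> nat" where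
  "refl_length W S w =
     (LEAST k. \<exists>ts. length ts = k \<and> set ts \<subseteq> reflections W S \<and> list_prod W ts = w)"

definition abs_le :: "('a, 'b) monoid_scheme \<Rightarrow> 'a set \<Rightarrow> 'a \<Rightarrow> 'a \<Rightarrow> bool" where
  "abs_le W S u v \<longleftrightarrow>
     refl_length W S u + refl_length W S (inv\<^bsub>W\<^esub> u \<otimes>\<^bsub>W\<^esub> v) = refl_length W S v"

definition abs_interval :: "('a, 'b) monoid_scheme \<Rightarrow> 'a set \<Rightarrow> 'a \<Rightarrow> 'a set" where
  "abs_interval W S c = {x \<in> carrier W. abs_le W S x c}"

definition refl_below :: "('a, 'b) monoid_scheme \<Rightarrow> 'a set \<Rightarrow> 'a \<Rightarrow> 'a set" where
  "refl_below W S x = {t \<in> reflections W S. abs_le W S t x}"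

definition refl_below_subgroup :: "('a, 'b) monoid_scheme \<Rightarrow> 'a set \<Rightarrow> 'a \<Rightarrow> 'a set" where
  "refl_below_subgroup W S x = generate W (refl_below W S x)"

definition reflection_subgroups :: "('a, 'b) monoid_scheme \<Rightarrow> 'a set \<Rightarrow> 'a set set" where
  "reflection_subgroups W S = {generate W R | R. R \<subseteq> reflections W S}"


section \<open>The geometric representation\<close>

(* The ambient real vector space is the type of finitely supported functions on 'a, and V is
   the subspace of functions supported on S, with basis the indicators of the elements of S. *)
definition simple_root :: "'a \<Rightarrow> ('a \<Rightarrow>\<^sub>0 real)" where
  "simple_root s = Poly_Mapping.single s 1"

definition geom_space :: "'a set \<Rightarrow> ('a \<Rightarrow>\<^sub>0 real) set" where
  "geom_space S = span (simple_root ` S)"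

definition geom_coeff :: "('a, 'b) monoid_scheme \<Rightarrow> 'a \<Rightarrow> 'a \<Rightarrow> real" where
  "geom_coeff W s t = (if cox_m W s t = 0 then - 1 else - cos (pi / real (cox_m W s t)))"

definition geom_form ::
    "('a, 'b) monoid_scheme \<Rightarrow> 'a set \<Rightarrow> ('a \<Rightarrow>\<^sub>0 real) \<Rightarrow> ('a \<Rightarrow>\<^sub>0 real) \<Rightarrow> real" where
  "geom_form W S u v =
     (\<Sum>s\<in>S. \<Sum>t\<in>S. Poly_Mapping.lookup u s * Poly_Mapping.lookup v t * geom_coeff W s t)"

definition geom_reflection ::
    "('a, 'b) monoid_scheme \<Rightarrow> 'a set \<Rightarrow> ('a \<Rightarrow>\<^sub>0 real) \<Rightarrow> ('a \<Rightarrow>\<^sub>0 real) \<Rightarrow> ('a \<Rightarrow>\<^sub>0 real)" where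
  "geom_reflection W S \<beta> v = v - (2 * geom_form W S \<beta> v) *\<^sub>R \<beta>"

(* w = s1 ... sk acts as the composite of the reflections in the simple roots of s1, ..., sk.
   The description is unambiguous because these reflections satisfy the Coxeter relations. *)
definition geom_act ::
    "('a, 'b) monoid_scheme \<Rightarrow> 'a set \<Rightarrow> 'a \<Rightarrow> ('a \<Rightarrow>\<^sub>0 real) \<Rightarrow> ('a \<Rightarrow>\<^sub>0 real)" where
  "geom_act W S w =
     (THE f. \<exists>ss\<in>lists S. list_prod W ss = w \<and>
        f = foldr (\<lambda>s. geom_reflection W S (simple_root s)) ss)"

definition root_system :: "('a, 'b) monoid_scheme \<Rightarrow> 'a set \<Rightarrow> ('a \<Rightarrow>\<^sub>0 real) set" where
  "root_system W S = {geom_act W S w (simple_root s) | w s. w \<in> carrier W \<and> s \<in> S}"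

definition positive_roots :: "('a, 'b) monoid_scheme \<Rightarrow> 'a set \<Rightarrow> ('a \<Rightarrow>\<^sub>0 real) set" where
  "positive_roots W S = {\<beta> \<in> root_system W S. \<forall>s\<in>S. 0 \<le> Poly_Mapping.lookup \<beta> s}"

definition refl_root :: "('a, 'b) monoid_scheme \<Rightarrow> 'a set \<Rightarrow> 'a \<Rightarrow> ('a \<Rightarrow>\<^sub>0 real)" where
  "refl_root W S t =
     (THE \<beta>. \<beta> \<in> positive_roots W S \<and>
        (\<forall>v\<in>geom_space S. geom_act W S t v = geom_reflection W S \<beta> v))"

(* span of the roots = sum of the lines they span *)
definition abs_moved_space :: "('a, 'b) monoid_scheme \<Rightarrow> 'a set \<Rightarrow> 'a \<Rightarrow> ('a \<Rightarrow>\<^sub>0 real) set" where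
  "abs_moved_space W S x = span (refl_root W S ` refl_below W S x)"


section \<open>Posets\<close>

definition abs_poset :: "('a, 'b) monoid_scheme \<Rightarrow> 'a set \<Rightarrow> 'a \<Rightarrow> 'a gorder" where
  "abs_poset W S c = \<lparr>carrier = abs_interval W S c, eq = (=), le = abs_le W S\<rparr>"

definition incl_poset :: "'c set set \<Rightarrow> 'c set gorder" where
  "incl_poset A = \<lparr>carrier = A, eq = (=), le = (\<subseteq>)\<rparr>"

definition subspaces :: "'v::real_vector set \<Rightarrow> 'v set set" where
  "subspaces V = {U. subspace U \<and> U \<subseteq> V}"

(* order_emb includes that both structures are partially ordered *)
definition poset_iso_onto_image ::
    "('c, 'e) gorder_scheme \<Rightarrow> ('d, 'f) gorder_scheme \<Rightarrow> ('c \<Rightarrow> 'd) \<Rightarrow> bool" where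
  "poset_iso_onto_image A B f \<longleftrightarrow>
     f \<in> carrier A \<rightarrow> carrier B \<and> inj_on f (carrier A) \<and> order_emb A B f"

end

theory Submission
  imports Defs
begin

text \<open>
  Let \<open>B\<close> be the bilinear form, \<open>T\<close> the set of reflections, \<open>\<rho> t\<close> the positive root of \<open>t\<close>, \<open>\<ell>\<close> the
  reflection length and \<open>AM x\<close> the absolute moved space. All three maps are monotone because the
  absolute order is transitive. Conversely, an inclusion between two sets of reflections below, or
  between the subgroups that they generate, forces the inclusion of the absolute moved spaces: every
  element of the subgroup attached to \<open>y\<close> moves vectors by elements of \<open>AM y\<close>, and a reflection \<open>t\<close>
  moves \<open>\<rho> t\<close> to its negative. So everything rests on one implication: if \<open>x\<close> and \<open>y\<close> lie
  below \<open>c\<close> and \<open>AM x \<subseteq> AM y\<close>, then \<open>x\<close> lies below \<open>y\<close>. Since \<open>c\<close> is a product of three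
  reflections, only the lengths 0 to 3 occur, and the essential geometry takes place in planes.

  The first ingredient is that a product of three reflections whose roots lie in a common plane is
  again a reflection, with root in that plane (\<open>coplanar_triple_reflection\<close>). In linear algebra the
  product of three such reflections is the reflection in an explicit vector of norm one. It remains
  to see that an element of \<open>W\<close> acting as a linear reflection in some vector of norm one belongs to
  \<open>T\<close>; this is \<open>reflection_of_linear_reflection\<close>, an induction on the Coxeter length in which
  conjugation by a descent makes the element shorter. It uses the basic theorem on the geometric
  representation, that \<open>w\<close> sends a simple root \<open>\<alpha> s\<close> to a nonnegative combination of simple roots
  unless \<open>s\<close> is a right descent of \<open>w\<close> (\<open>nonneg_of_ascent\<close>), and the resulting faithfulness.

  The second ingredient is that, if \<open>\<ell> (t1 t2) = 2\<close>, then \<open>AM (t1 t2)\<close> is the plane spanned by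
  \<open>\<rho> t1\<close> and \<open>\<rho> t2\<close>. The point is that \<open>t3 t4 = t1 t2\<close> with \<open>t3 \<noteq> t4\<close> forces \<open>\<rho> t3\<close> into that
  plane (\<open>root_of_factor_in_plane\<close>). The moved space of \<open>t1 t2\<close> on \<open>V\<close> can be too small to show
  this, as \<open>B\<close> may be degenerate; for parallel reflections of an affine group it is only a line.
  The remedy is to enlarge \<open>V\<close> by its dual: each linear functional \<open>f\<close> gives an action of \<open>W\<close> on
  \<open>V\<close> by affine maps, in which \<open>t\<close> sends \<open>v\<close> to \<open>v - 2 (B (\<rho> t) v + f (\<rho> t)) (\<rho> t)\<close>, and \<open>f\<close> can
  be chosen freely on linearly independent roots.

  Given these, a reflection with root in \<open>AM y\<close> lies below \<open>y\<close> when \<open>\<ell> y = 2\<close>. If \<open>x\<close> and \<open>y\<close>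
  both have length 2 with the same plane, and \<open>c = x r = y r'\<close> has length 3, then \<open>r r' = x\<inverse> y\<close> is a
  product of four, hence of two, reflections of that plane. If \<open>r \<noteq> r'\<close>, this puts \<open>\<rho> r\<close> in the
  plane and makes \<open>c = x r\<close> a reflection, a contradiction.
\<close>

section \<open>Lengths of words\<close>

definition word_length :: "('a, 'b) monoid_scheme \<Rightarrow> 'a set \<Rightarrow> 'a \<Rightarrow> nat" where
  "word_length W X w = (LEAST k. \<exists>ws. length ws = k \<and> set ws \<subseteq> X \<and> list_prod W ws = w)"

context group
begin

lemma list_prod_Nil [simp]: "list_prod G [] = \<one>"
  by (simp add: list_prod_def)

lemma list_prod_Cons [simp]: "list_prod G (x # xs) = x \<otimes> list_prod G xs"
  by (simp add: list_prod_def)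

lemma list_prod_closed: "set xs \<subseteq> carrier G \<Longrightarrow> list_prod G xs \<in> carrier G"
  by (induction xs) auto

lemma list_prod_append:
  "set xs \<subseteq> carrier G \<Longrightarrow> set ys \<subseteq> carrier G \<Longrightarrow>
    list_prod G (xs @ ys) = list_prod G xs \<otimes> list_prod G ys"
  by (induction xs) (auto simp: m_assoc list_prod_closed)

lemma list_prod_rev:
  assumes "set xs \<subseteq> carrier G" and "\<And>x. x \<in> set xs \<Longrightarrow> inv x = x"
  shows "list_prod G (rev xs) = inv (list_prod G xs)"
  using assms by (induction xs) (auto simp: list_prod_append list_prod_closed inv_mult_group)

lemma generate_involutions_word:
  assumes "X \<subseteq> carrier G" and "\<And>x. x \<in> X \<Longrightarrow> inv x = x" and "w \<in> generate G X"
  shows "\<exists>ws. set ws \<subseteq> X \<and> list_prod G ws = w"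
  using assms(3)
proof (induction rule: generate.induct)
  case one
  show ?case by (rule exI[of _ "[]"]) simp
next
  case (incl h)
  then show ?case using assms(1) by (intro exI[of _ "[h]"]) auto
next
  case (inv h)
  then show ?case using assms(1,2) by (intro exI[of _ "[h]"]) auto
next
  case (eng h1 h2)
  then obtain us vs where "set us \<subseteq> X" "list_prod G us = h1" "set vs \<subseteq> X" "list_prod G vs = h2"
    by blast
  then show ?case using assms(1) by (intro exI[of _ "us @ vs"]) (auto simp: list_prod_append)
qed

end

text \<open>The group will be used with two generating sets of involutions, the simple reflections and all
  reflections; they give the Coxeter length and the reflection length.\<close>

locale involution_generated = group W for W (structure) +
  fixes X :: "'a set"
  assumes gens_closed: "X \<subseteq> carrier W"
    and gens_inv: "x \<in> X \<Longrightarrow> inv x = x"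
    and gens_generate: "generate W X = carrier W"
begin

abbreviation len :: "'a \<Rightarrow> nat" where
  "len \<equiv> word_length W X"

lemma len_le:
  "set ws \<subseteq> X \<Longrightarrow> len (list_prod W ws) \<le> length ws"
  unfolding word_length_def by (rule Least_le) auto

lemma minimal_word:
  assumes "w \<in> carrier W"
  obtains ws where "set ws \<subseteq> X" "list_prod W ws = w" "length ws = len w"
proof -
  have "w \<in> generate W X"
    using assms gens_generate by simp
  then have "\<exists>k ws. length ws = k \<and> set ws \<subseteq> X \<and> list_prod W ws = w"
    using generate_involutions_word[OF gens_closed gens_inv] by blast
  from LeastI_ex[OF this] show thesis
    using that unfolding word_length_def by blast
qed

lemma len_one [simp]: "len \<one> = 0"
  using len_le[of "[]"] by simp

lemma len_gen: "x \<in> X \<Longrightarrow> len x \<le> 1"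
  using len_le[of "[x]"] gens_closed by auto

lemma len_mult:
  assumes "u \<in> carrier W" "v \<in> carrier W"
  shows "len (u \<otimes> v) \<le> len u + len v"
proof -
  obtain us where us: "set us \<subseteq> X" "list_prod W us = u" "length us = len u"
    using assms(1) by (rule minimal_word)
  obtain vs where vs: "set vs \<subseteq> X" "list_prod W vs = v" "length vs = len v"
    using assms(2) by (rule minimal_word)
  have "list_prod W (us @ vs) = u \<otimes> v"
    using us vs gens_closed by (subst list_prod_append) auto
  then show ?thesis
    using len_le[of "us @ vs"] us vs by auto
qed

lemma len_inv_le: "u \<in> carrier W \<Longrightarrow> len (inv u) \<le> len u"
proof -
  assume "u \<in> carrier W"
  then obtain us where us: "set us \<subseteq> X" "list_prod W us = u" "length us = len u"
    by (rule minimal_word)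
  have "list_prod W (rev us) = inv u"
    using us gens_closed gens_inv list_prod_rev[of us] by auto
  then show ?thesis
    using len_le[of "rev us"] us by auto
qed

lemma len_inv: "u \<in> carrier W \<Longrightarrow> len (inv u) = len u"
  using len_inv_le[of u] len_inv_le[of "inv u"] by simp

lemma len_0_iff: "w \<in> carrier W \<Longrightarrow> len w = 0 \<longleftrightarrow> w = \<one>"
  by (metis len_one length_0_conv list_prod_Nil minimal_word)

lemma len_1_gen:
  assumes "w \<in> carrier W" "len w = 1"
  shows "w \<in> X"
proof -
  obtain ws where "set ws \<subseteq> X" "list_prod W ws = w" "length ws = 1"
    using minimal_word[OF assms(1)] assms(2) by metis
  then show ?thesis
    using gens_closed by (auto simp: length_Suc_conv)
qed

lemma right_descent:
  assumes "w \<in> carrier W" "w \<noteq> \<one>"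
  obtains x where "x \<in> X" "len (w \<otimes> x) < len w"
proof -
  obtain ws where ws: "set ws \<subseteq> X" "list_prod W ws = w" "length ws = len w"
    using assms(1) by (rule minimal_word)
  with assms(2) have "ws \<noteq> []"
    by auto
  then obtain vs x where vs: "ws = vs @ [x]"
    by (metis rev_exhaust)
  with ws gens_closed have x: "x \<in> X" "x \<in> carrier W" "set vs \<subseteq> X" "set vs \<subseteq> carrier W"
    by auto
  then have "w = list_prod W vs \<otimes> x"
    using ws(2) vs by (auto simp: list_prod_append)
  then have "w \<otimes> x = list_prod W vs \<otimes> (x \<otimes> x)"
    using x by (simp add: m_assoc list_prod_closed)
  also have "x \<otimes> x = \<one>"
    using gens_inv[OF x(1)] x(2) by (metis l_inv)
  finally have "w \<otimes> x = list_prod W vs"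
    using x by (simp add: list_prod_closed)
  then have "len (w \<otimes> x) < len w"
    using len_le[OF x(3)] ws(3) vs by auto
  with x(1) show thesis
    by (rule that)
qed

end


section \<open>Two reflections generate a dihedral action\<close>

text \<open>Along the alternating product of the two reflections the values of \<open>\<phi>\<close> and \<open>\<psi>\<close> satisfy the
  recurrence \<open>g (j + 2) = 2 cos \<theta> g (j + 1) - g j\<close>, whose solutions are combinations of sines of
  multiples of \<open>\<theta>\<close>. The hypotheses only prescribe how \<open>\<phi>\<close> and \<open>\<psi>\<close> vary in the directions \<open>a\<close> and
  \<open>b\<close>, so that they cover affine as well as linear reflections.\<close>

lemma dihedral_iterate:
  fixes \<phi> \<psi> :: "'v::real_vector \<Rightarrow> real" and a b :: 'v and \<theta> :: real
  assumes \<phi>: "\<And>v x y. \<phi> (v + x *\<^sub>R a + y *\<^sub>R b) = \<phi> v + x - y * cos \<theta>"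
    and \<psi>: "\<And>v x y. \<psi> (v + x *\<^sub>R a + y *\<^sub>R b) = \<psi> v - x * cos \<theta> + y"
  defines "A \<equiv> \<lambda>v. v - (2 * \<phi> v) *\<^sub>R a" and "B \<equiv> \<lambda>v. v - (2 * \<psi> v) *\<^sub>R b"
  shows "\<exists>x y. ((A \<circ> B) ^^ k) v = v + x *\<^sub>R a + y *\<^sub>R b \<and>
     sin \<theta> * \<phi> (((A \<circ> B) ^^ k) v) = - (\<psi> v * sin (real (2*k) * \<theta>) + \<phi> v * sin (real (2*k) * \<theta> - \<theta>)) \<and>
     sin \<theta> * \<psi> (((A \<circ> B) ^^ k) v) = \<psi> v * sin (real (2*k) * \<theta> + \<theta>) + \<phi> v * sin (real (2*k) * \<theta>)"
proof (induction k)
  case 0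
  show ?case
    by (rule exI[of _ 0], rule exI[of _ 0]) simp
next
  case (Suc k)
  define u where "u = ((A \<circ> B) ^^ k) v"
  define \<gamma> where "\<gamma> = real (2*k) * \<theta>"
  obtain x y where u: "u = v + x *\<^sub>R a + y *\<^sub>R b"
    and pu: "sin \<theta> * \<phi> u = - (\<psi> v * sin \<gamma> + \<phi> v * sin (\<gamma> - \<theta>))"
    and qu: "sin \<theta> * \<psi> u = \<psi> v * sin (\<gamma> + \<theta>) + \<phi> v * sin \<gamma>"
    using Suc.IH unfolding u_def \<gamma>_def by blast
  define q where "q = \<psi> u"
  define p where "p = \<phi> u + 2 * q * cos \<theta>"
  have Bu: "B u = u + 0 *\<^sub>R a + (- 2 * q) *\<^sub>R b"
    by (simp add: B_def q_def)
  have "\<phi> (B u) = p"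
    unfolding Bu \<phi> by (simp add: p_def)
  then have ABu: "(A \<circ> B) u = u + (- 2 * p) *\<^sub>R a + (- 2 * q) *\<^sub>R b"
    by (simp add: A_def) (simp add: Bu)
  have s2: "sin (\<gamma> + 2 * \<theta>) = 2 * cos \<theta> * sin (\<gamma> + \<theta>) - sin \<gamma>"
  proof -
    have "sin (\<gamma> + 2 * \<theta>) = sin ((\<gamma> + \<theta>) + \<theta>)" "sin \<gamma> = sin ((\<gamma> + \<theta>) - \<theta>)"
      by (simp_all add: algebra_simps)
    then show ?thesis
      by (simp only: sin_add[of "\<gamma> + \<theta>" \<theta>] sin_diff[of "\<gamma> + \<theta>" \<theta>]) (simp add: algebra_simps)
  qed
  have s1: "sin (\<gamma> + \<theta>) = 2 * cos \<theta> * sin \<gamma> - sin (\<gamma> - \<theta>)"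
    by (simp add: sin_add sin_diff)
  have s3: "sin (\<gamma> + 3 * \<theta>) = 2 * cos \<theta> * sin (\<gamma> + 2 * \<theta>) - sin (\<gamma> + \<theta>)"
  proof -
    have "sin (\<gamma> + 3 * \<theta>) = sin ((\<gamma> + 2 * \<theta>) + \<theta>)" "sin (\<gamma> + \<theta>) = sin ((\<gamma> + 2 * \<theta>) - \<theta>)"
      by (simp_all add: algebra_simps)
    then show ?thesis
      by (simp only: sin_add[of "\<gamma> + 2 * \<theta>" \<theta>] sin_diff[of "\<gamma> + 2 * \<theta>" \<theta>])
        (simp add: algebra_simps)
  qed
  have sp: "sin \<theta> * p = \<psi> v * sin (\<gamma> + 2 * \<theta>) + \<phi> v * sin (\<gamma> + \<theta>)"
  proof -
    have "sin \<theta> * p = sin \<theta> * \<phi> u + 2 * cos \<theta> * (sin \<theta> * \<psi> u)"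
      by (simp add: p_def q_def algebra_simps)
    also have "\<dots> = \<psi> v * sin (\<gamma> + 2 * \<theta>) + \<phi> v * sin (\<gamma> + \<theta>)"
      unfolding pu qu s2 by (subst (2) s1) (simp add: algebra_simps)
    finally show ?thesis .
  qed
  have "\<phi> ((A \<circ> B) u) = - p" "\<psi> ((A \<circ> B) u) = 2 * cos \<theta> * p - q"
    unfolding ABu \<phi> \<psi> by (simp_all add: p_def q_def algebra_simps)
  then have \<phi>': "sin \<theta> * \<phi> ((A \<circ> B) u) = - (sin \<theta> * p)"
    and \<psi>': "sin \<theta> * \<psi> ((A \<circ> B) u) = 2 * cos \<theta> * (sin \<theta> * p) - sin \<theta> * \<psi> u"
    by (simp_all add: q_def right_diff_distrib del: o_apply)
  have angles: "real (2 * Suc k) * \<theta> = \<gamma> + 2 * \<theta>" "\<gamma> + 2 * \<theta> - \<theta> = \<gamma> + \<theta>"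
      "\<gamma> + 2 * \<theta> + \<theta> = \<gamma> + 3 * \<theta>"
    by (simp_all add: \<gamma>_def algebra_simps)
  have step: "((A \<circ> B) ^^ Suc k) v = (A \<circ> B) u"
    by (simp add: u_def)
  have "2 * cos \<theta> * (sin \<theta> * p) - sin \<theta> * \<psi> u =
      \<psi> v * sin (\<gamma> + 3 * \<theta>) + \<phi> v * sin (\<gamma> + 2 * \<theta>)"
    unfolding sp qu s3 by (subst (3) s2) (simp add: algebra_simps)
  moreover have "(A \<circ> B) u = v + (x - 2 * p) *\<^sub>R a + (y - 2 * q) *\<^sub>R b"
    by (subst ABu, subst u) (simp add: algebra_simps)
  ultimately show ?case
    unfolding step angles \<phi>' \<psi>' sp by blast
qed

text \<open>After \<open>m\<close> steps the angle has grown by \<open>2 \<pi>\<close>, so \<open>\<phi>\<close> and \<open>\<psi>\<close> are back at their initial values.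
  The displacement \<open>x a + y b\<close> is therefore annihilated by the Gram matrix of \<open>a\<close> and \<open>b\<close>, of
  determinant \<open>sin\<^sup>2 \<theta> \<noteq> 0\<close>.\<close>

lemma dihedral_relation:
  fixes \<phi> \<psi> :: "'v::real_vector \<Rightarrow> real" and a b :: 'v
  assumes \<theta>: "\<theta> = pi / real m" and m: "m \<ge> 2"
    and \<phi>: "\<And>v x y. \<phi> (v + x *\<^sub>R a + y *\<^sub>R b) = \<phi> v + x - y * cos \<theta>"
    and \<psi>: "\<And>v x y. \<psi> (v + x *\<^sub>R a + y *\<^sub>R b) = \<psi> v - x * cos \<theta> + y"
  shows "((\<lambda>v. v - (2 * \<phi> v) *\<^sub>R a) \<circ> (\<lambda>v. v - (2 * \<psi> v) *\<^sub>R b)) ^^ m = id"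
proof
  fix v
  define u where "u = (((\<lambda>v. v - (2 * \<phi> v) *\<^sub>R a) \<circ> (\<lambda>v. v - (2 * \<psi> v) *\<^sub>R b)) ^^ m) v"
  have "real (2 * m) * \<theta> = 2 * pi"
    using m by (simp add: \<theta>)
  then obtain x y where u: "u = v + x *\<^sub>R a + y *\<^sub>R b"
    and "sin \<theta> * \<phi> u = - (\<psi> v * sin (2 * pi) + \<phi> v * sin (2 * pi - \<theta>))"
    and "sin \<theta> * \<psi> u = \<psi> v * sin (2 * pi + \<theta>) + \<phi> v * sin (2 * pi)"
    using dihedral_iterate[of \<phi> a b \<theta> \<psi> m v, OF \<phi> \<psi>] unfolding u_def by metis
  then have e: "sin \<theta> * \<phi> u = sin \<theta> * \<phi> v" "sin \<theta> * \<psi> u = sin \<theta> * \<psi> v"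
    by (simp_all add: sin_diff sin_add)
  have "0 < \<theta>" "\<theta> < pi"
    using m by (simp_all add: \<theta> field_simps)
  then have s: "sin \<theta> > 0"
    by (rule sin_gt_zero)
  with e have "\<phi> u = \<phi> v" "\<psi> u = \<psi> v"
    by auto
  then have 1: "x = y * cos \<theta>" and 2: "y = x * cos \<theta>"
    using u \<phi> \<psi> by auto
  have "x * (sin \<theta>)\<^sup>2 = x * (1 - (cos \<theta>)\<^sup>2)"
    by (simp add: sin_squared_eq)
  also have "\<dots> = x - (x * cos \<theta>) * cos \<theta>"
    by (simp add: algebra_simps power2_eq_square)
  also have "\<dots> = 0"
    using 1 2 by simp
  finally have "x = 0"
    using s by simp
  with 2 u show "u = id v"
    by simp
qed


section \<open>The action of a Coxeter group on its geometric representation\<close>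

lemma lookup_scaleR_real [simp]:
  "Poly_Mapping.lookup (r *\<^sub>R v) s = r * Poly_Mapping.lookup (v :: 'a \<Rightarrow>\<^sub>0 real) s"
proof -
  have "finite {i. r *\<^sub>R Poly_Mapping.lookup v i \<noteq> 0}"
    by (rule finite_subset[OF _ finite_lookup[of v]]) auto
  then show ?thesis
    by (simp add: scaleR_poly_mapping_def Abs_poly_mapping_inverse)
qed

locale finite_rank_coxeter = group W for W (structure) +
  fixes S :: "'a set"
  assumes coxeter: "coxeter_system W S" and finite_S: "finite S"
begin

abbreviation B :: "('a \<Rightarrow>\<^sub>0 real) \<Rightarrow> ('a \<Rightarrow>\<^sub>0 real) \<Rightarrow> real" where
  "B \<equiv> geom_form W S"

abbreviation \<alpha> :: "'a \<Rightarrow> ('a \<Rightarrow>\<^sub>0 real)" where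
  "\<alpha> \<equiv> simple_root"

lemma S_closed: "S \<subseteq> carrier W"
  using coxeter by (simp add: coxeter_system_def)

lemma S_carrier [simp]: "s \<in> S \<Longrightarrow> s \<in> carrier W"
  using S_closed by auto

lemma S_ord: "s \<in> S \<Longrightarrow> ord s = 2"
  using coxeter by (simp add: coxeter_system_def)

lemma S_square [simp]: "s \<in> S \<Longrightarrow> s \<otimes> s = \<one>"
  using pow_ord_eq_1[of s] S_ord[of s] by (simp add: numeral_2_eq_2)

lemma S_cancel [simp]: "s \<in> S \<Longrightarrow> w \<in> carrier W \<Longrightarrow> s \<otimes> (s \<otimes> w) = w"
  by (simp flip: m_assoc)

lemma S_inv [simp]: "s \<in> S \<Longrightarrow> inv s = s"
  by (simp add: inv_equality)

sublocale cox: involution_generated W S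
  using coxeter by unfold_locales (auto simp: coxeter_system_def)

abbreviation len :: "'a \<Rightarrow> nat" where
  "len \<equiv> word_length W S"

lemma carrier_induct [consumes 1, case_names one mult]:
  assumes "w \<in> carrier W" and "P \<one>"
    and "\<And>s w. s \<in> S \<Longrightarrow> w \<in> carrier W \<Longrightarrow> P w \<Longrightarrow> P (s \<otimes> w)"
  shows "P w"
proof -
  obtain ws where ws: "set ws \<subseteq> S" "list_prod W ws = w"
    using assms(1) by (rule cox.minimal_word)
  have "set ws \<subseteq> S \<Longrightarrow> P (list_prod W ws)"
    using S_closed by (induction ws) (auto intro!: assms(2,3) list_prod_closed)
  with ws show ?thesis
    by simp
qed

lemma cox_m_sym: "s \<in> S \<Longrightarrow> t \<in> S \<Longrightarrow> cox_m W s t = cox_m W t s"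
  using ord_inv[of "s \<otimes> t"] by (simp add: cox_m_def inv_mult_group)

lemma cox_m_self: "s \<in> S \<Longrightarrow> cox_m W s s = 1"
  by (simp add: cox_m_def)

lemma cox_m_neq_1:
  assumes "s \<in> S" "t \<in> S" "s \<noteq> t"
  shows "cox_m W s t \<noteq> 1"
proof
  assume "cox_m W s t = 1"
  then have "s \<otimes> t = \<one>"
    using pow_ord_eq_1[of "s \<otimes> t"] assms by (simp add: cox_m_def)
  then have "s = inv t"
    using assms by (metis S_carrier inv_equality inv_inv S_inv)
  with assms show False
    by simp
qed

lemma geom_coeff_sym: "s \<in> S \<Longrightarrow> t \<in> S \<Longrightarrow> geom_coeff W s t = geom_coeff W t s"
  by (simp add: geom_coeff_def cox_m_sym)

lemma B_sym: "B u v = B v u"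
proof -
  have "B u v = (\<Sum>t\<in>S. \<Sum>s\<in>S.
      Poly_Mapping.lookup u s * Poly_Mapping.lookup v t * geom_coeff W s t)"
    unfolding geom_form_def by (rule sum.swap)
  also have "\<dots> = B v u"
    unfolding geom_form_def by (intro sum.cong) (auto simp: geom_coeff_sym mult_ac)
  finally show ?thesis .
qed

lemma B_linear_left: "linear (\<lambda>u. B u v)"
  by (rule linearI) (simp_all add: geom_form_def lookup_add algebra_simps sum.distrib sum_distrib_left)

lemma B_linear_right: "linear (B u)"
proof -
  have "B u = (\<lambda>v. B v u)"
    by (rule ext) (rule B_sym)
  then show ?thesis
    using B_linear_left[of u] by simp
qed

lemmas B_simps [simp] =
  linear_add[OF B_linear_left] linear_diff[OF B_linear_left] linear_scale[OF B_linear_left]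
  linear_neg[OF B_linear_left] linear_0[OF B_linear_left]
  linear_add[OF B_linear_right] linear_diff[OF B_linear_right] linear_scale[OF B_linear_right]
  linear_neg[OF B_linear_right] linear_0[OF B_linear_right]

lemma lookup_simple_root: "Poly_Mapping.lookup (\<alpha> s) u = (if u = s then 1 else 0)"
  by (simp add: simple_root_def lookup_single when_def)

lemma B_simple_roots: "s \<in> S \<Longrightarrow> t \<in> S \<Longrightarrow> B (\<alpha> s) (\<alpha> t) = geom_coeff W s t"
proof -
  assume st: "s \<in> S" "t \<in> S"
  have "B (\<alpha> s) (\<alpha> t) =
      (\<Sum>u\<in>S. if u = s then (\<Sum>v\<in>S. if v = t then geom_coeff W u v else 0) else 0)"
    unfolding geom_form_def
    by (rule sum.cong) (auto simp: lookup_simple_root intro!: sum.cong sum.neutral)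
  with st show ?thesis
    using finite_S by simp
qed

lemma B_simple_root_self [simp]: "s \<in> S \<Longrightarrow> B (\<alpha> s) (\<alpha> s) = 1"
  by (simp add: B_simple_roots geom_coeff_def cox_m_self)

text \<open>The orthogonal reflection in \<open>(\<beta>, 0)\<close> on \<open>V \<oplus> V\<^sup>*\<close>, with the form
  \<open>B u v + f v + g u\<close> of \<open>(u, f)\<close> and \<open>(v, g)\<close>, leaves the second component alone. For a fixed
  second component \<open>f\<close> it is the following affine map of \<open>V\<close>. For \<open>f = 0\<close> it is the reflection of
  the geometric representation.\<close>

definition aff_refl ::
    "(('a \<Rightarrow>\<^sub>0 real) \<Rightarrow> real) \<Rightarrow> ('a \<Rightarrow>\<^sub>0 real) \<Rightarrow> ('a \<Rightarrow>\<^sub>0 real) \<Rightarrow> ('a \<Rightarrow>\<^sub>0 real)" where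
  "aff_refl f \<beta> v = v - (2 * (B \<beta> v + f \<beta>)) *\<^sub>R \<beta>"

definition aff_word ::
    "(('a \<Rightarrow>\<^sub>0 real) \<Rightarrow> real) \<Rightarrow> 'a list \<Rightarrow> ('a \<Rightarrow>\<^sub>0 real) \<Rightarrow> ('a \<Rightarrow>\<^sub>0 real)" where
  "aff_word f = foldr (\<lambda>s. aff_refl f (\<alpha> s))"

lemma aff_word_Nil [simp]: "aff_word f [] = id"
  by (simp add: aff_word_def id_def)

lemma aff_word_Cons [simp]: "aff_word f (s # ws) = aff_refl f (\<alpha> s) \<circ> aff_word f ws"
  by (simp add: aff_word_def)

lemma aff_word_append: "aff_word f (us @ vs) = aff_word f us \<circ> aff_word f vs"
  by (induction us) auto

lemma aff_word_replicate:
  "aff_word f (concat (replicate m [s, t])) = (aff_refl f (\<alpha> s) \<circ> aff_refl f (\<alpha> t)) ^^ m"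
  by (induction m) (auto simp: o_assoc)

lemma aff_word_relator:
  assumes "s \<in> S" "t \<in> S"
  shows "aff_word f (concat (replicate (cox_m W s t) [s, t])) = id"
proof (cases "s = t")
  case True
  have "aff_refl f (\<alpha> s) (aff_refl f (\<alpha> s) v) = v" for v
    using assms by (simp add: aff_refl_def algebra_simps flip: scaleR_add_left)
  with True assms show ?thesis
    by (simp add: cox_m_self fun_eq_iff)
next
  case False
  show ?thesis
  proof (cases "cox_m W s t = 0")
    case m: False
    define \<theta> where "\<theta> = pi / real (cox_m W s t)"
    have "B (\<alpha> s) (\<alpha> t) = - cos \<theta>" "B (\<alpha> t) (\<alpha> s) = - cos \<theta>"
      using assms m by (simp_all add: B_simple_roots geom_coeff_def \<theta>_def cox_m_sym[of t s])
    moreover have "cox_m W s t \<ge> 2"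
      using m cox_m_neq_1[OF assms False] by simp
    ultimately show ?thesis
      unfolding aff_word_replicate aff_refl_def using assms
      by (intro dihedral_relation[OF \<theta>_def]) (auto simp: algebra_simps)
  qed simp
qed

lemma aff_word_cong: "cox_equiv W S us vs \<Longrightarrow> aff_word f us = aff_word f vs"
  by (induction rule: cox_equiv.induct) (auto simp: aff_word_append aff_word_relator)

text \<open>By \<open>aff_word_cong\<close> the choice of a word for \<open>w\<close> does not matter.\<close>

definition aff_act ::
    "(('a \<Rightarrow>\<^sub>0 real) \<Rightarrow> real) \<Rightarrow> 'a \<Rightarrow> ('a \<Rightarrow>\<^sub>0 real) \<Rightarrow> ('a \<Rightarrow>\<^sub>0 real)" where
  "aff_act f w = aff_word f (SOME ws. set ws \<subseteq> S \<and> list_prod W ws = w)"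

abbreviation act :: "'a \<Rightarrow> ('a \<Rightarrow>\<^sub>0 real) \<Rightarrow> ('a \<Rightarrow>\<^sub>0 real)" where
  "act \<equiv> aff_act (\<lambda>_. 0)"

lemma aff_act_word:
  assumes "set ws \<subseteq> S"
  shows "aff_act f (list_prod W ws) = aff_word f ws"
proof -
  define vs where "vs = (SOME vs. set vs \<subseteq> S \<and> list_prod W vs = list_prod W ws)"
  have "set vs \<subseteq> S \<and> list_prod W vs = list_prod W ws"
    unfolding vs_def by (rule someI[of _ ws]) (simp add: assms)
  then have "cox_equiv W S vs ws"
    using coxeter assms by (auto simp: coxeter_system_def in_lists_conv_set subset_iff)
  then show ?thesis
    unfolding aff_act_def vs_def[symmetric] by (rule aff_word_cong)
qed

lemma aff_act_one [simp]: "aff_act f \<one> = id"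
  using aff_act_word[of "[]"] by simp

lemma aff_act_mult:
  assumes "u \<in> carrier W" "v \<in> carrier W"
  shows "aff_act f (u \<otimes> v) = aff_act f u \<circ> aff_act f v"
proof -
  obtain us where us: "set us \<subseteq> S" "list_prod W us = u"
    using assms(1) by (rule cox.minimal_word)
  obtain vs where vs: "set vs \<subseteq> S" "list_prod W vs = v"
    using assms(2) by (rule cox.minimal_word)
  have "list_prod W (us @ vs) = u \<otimes> v"
    using us vs S_closed by (subst list_prod_append) auto
  then show ?thesis
    using aff_act_word[of "us @ vs"] aff_act_word[of us] aff_act_word[of vs] us vs
    by (simp add: aff_word_append)
qed

lemma aff_act_gen: "s \<in> S \<Longrightarrow> aff_act f s = aff_refl f (\<alpha> s)"
  using aff_act_word[of "[s]" f] by simp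

lemma aff_act_inv: "w \<in> carrier W \<Longrightarrow> aff_act f w (aff_act f (inv w) v) = v"
  using aff_act_mult[of w "inv w" f] by (metis aff_act_one comp_apply id_apply inv_closed r_inv)

lemma geom_act_eq:
  assumes "w \<in> carrier W"
  shows "geom_act W S w = act w"
proof -
  obtain ws where ws: "set ws \<subseteq> S" "list_prod W ws = w"
    using assms by (rule cox.minimal_word)
  have *: "foldr (\<lambda>s. geom_reflection W S (simple_root s)) ss = aff_word (\<lambda>_. 0) ss" for ss
    by (simp add: aff_word_def aff_refl_def[abs_def] geom_reflection_def[abs_def])
  have "aff_word (\<lambda>_. 0) ss = act w" if "ss \<in> lists S" "list_prod W ss = w" for ss
    using that aff_act_word[of ss] by (auto simp: in_lists_conv_set subset_iff)
  moreover have "ws \<in> lists S"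
    using ws(1) by auto
  ultimately show ?thesis
    unfolding geom_act_def * using ws(2) by (intro the_equality) metis+
qed

lemma act_linear: "w \<in> carrier W \<Longrightarrow> linear (act w)"
proof (induction rule: carrier_induct)
  case one
  show ?case by (rule linearI) simp_all
next
  case (mult s w)
  have "linear (act s)"
    using mult by (intro linearI) (simp_all add: aff_act_gen aff_refl_def algebra_simps)
  then show ?case
    using linear_compose[of "act w" "act s"] mult by (simp add: aff_act_mult comp_def)
qed

lemma act_B: "w \<in> carrier W \<Longrightarrow> B (act w u) (act w v) = B u v"
proof (induction arbitrary: u v rule: carrier_induct)
  case (mult s w)
  have "B (act s u) (act s v) = B u v" for u v
    using mult by (simp add: aff_act_gen aff_refl_def B_sym[of u "\<alpha> s"] algebra_simps)
  then show ?case
    using mult by (simp add: aff_act_mult)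
qed simp

lemma aff_act_add:
  "w \<in> carrier W \<Longrightarrow> aff_act f w (v + x) = aff_act f w v + act w x"
proof (induction arbitrary: v x rule: carrier_induct)
  case (mult s w)
  then show ?case
    by (simp add: aff_act_mult) (simp add: aff_act_gen aff_refl_def algebra_simps)
qed simp

text \<open>Invariance of the form on \<open>V \<oplus> V\<^sup>*\<close> under \<open>W\<close>, for pairs whose first member lies in \<open>V\<close>.\<close>

lemma aff_act_functional:
  assumes "linear f" "w \<in> carrier W"
  shows "B (act w \<beta>) (aff_act f w v) + f (act w \<beta>) = B \<beta> v + f \<beta>"
  using assms(2)
proof (induction arbitrary: v \<beta> rule: carrier_induct)
  case (mult s w)
  have "B (act s \<beta>) (aff_act f s v) + f (act s \<beta>) = B \<beta> v + f \<beta>" for \<beta> v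
    using mult assms(1)
    by (simp add: aff_act_gen aff_refl_def linear_diff linear_scale B_sym[of \<beta> "\<alpha> s"] algebra_simps)
  then show ?case
    using mult by (simp add: aff_act_mult)
qed simp

lemma aff_act_conj:
  assumes "linear f" "w \<in> carrier W" "s \<in> S"
  shows "aff_act f (w \<otimes> s \<otimes> inv w) = aff_refl f (act w (\<alpha> s))"
proof
  fix v
  define u where "u = aff_act f (inv w) v"
  have u: "aff_act f w u = v"
    unfolding u_def using assms(2) by (rule aff_act_inv)
  have "aff_act f (w \<otimes> s \<otimes> inv w) v = aff_act f w (aff_act f s u)"
    using assms by (simp add: aff_act_mult u_def)
  also have "\<dots> = aff_act f w (u + (- 2 * (B (\<alpha> s) u + f (\<alpha> s))) *\<^sub>R \<alpha> s)"
    using assms by (simp add: aff_act_gen aff_refl_def algebra_simps)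
  also have "\<dots> = v + (- 2 * (B (\<alpha> s) u + f (\<alpha> s))) *\<^sub>R act w (\<alpha> s)"
    using assms by (simp add: aff_act_add u linear_scale[OF act_linear] del: scaleR_minus_left)
  also have "B (\<alpha> s) u + f (\<alpha> s) = B (act w (\<alpha> s)) v + f (act w (\<alpha> s))"
    using aff_act_functional[OF assms(1,2), of "\<alpha> s" u] u by simp
  finally show "aff_act f (w \<otimes> s \<otimes> inv w) v = aff_refl f (act w (\<alpha> s)) v"
    by (simp add: aff_refl_def algebra_simps)
qed

end


section \<open>Positive and negative roots\<close>

text \<open>The letters alternate from right to left, starting with \<open>t\<close>: multiplying a group element by the
  first letters of the word leaves its right end, and with it the action on a vector, in place.\<close>

primrec alt :: "'a \<Rightarrow> 'a \<Rightarrow> nat \<Rightarrow> 'a list" where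
  "alt s t 0 = []"
| "alt s t (Suc k) = (if even k then t else s) # alt s t k"

lemma alt_snoc: "alt s t (Suc k) = alt t s k @ [t]"
  by (induction k) auto

lemma length_alt [simp]: "length (alt s t k) = k"
  by (induction k) auto

lemma set_alt: "set (alt s t k) \<subseteq> {s, t}"
  by (induction k) auto

lemma alt_add: "\<exists>us. length us = i \<and> set us \<subseteq> {s, t} \<and> alt s t (i + k) = us @ alt s t k"
proof (induction i)
  case (Suc i)
  then obtain us where "length us = i" "set us \<subseteq> {s, t}" "alt s t (i + k) = us @ alt s t k"
    by blast
  then show ?case
    by (intro exI[of _ "(if even (i + k) then t else s) # us"]) simp
qed simp

text \<open>The solutions are \<open>sin ((k + 1) \<theta>) / sin \<theta>\<close> with \<open>\<theta> = \<pi> / m\<close>, the Chebyshev polynomials of the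
  second kind at \<open>cos \<theta>\<close>, and their limit \<open>k + 1\<close> when \<open>m\<close> is infinite.\<close>

lemma chebyshev_nonneg:
  fixes m :: nat
  assumes "m \<noteq> 1"
  defines "C \<equiv> if m = 0 then 1 else cos (pi / real m)"
  obtains a :: "nat \<Rightarrow> real" where "a 0 = 1" "a (Suc 0) = 2 * C"
    "\<And>k. a (Suc (Suc k)) = 2 * C * a (Suc k) - a k"
    "\<And>k. m = 0 \<or> k < m \<Longrightarrow> 0 \<le> a k"
proof (cases "m = 0")
  case True
  show thesis
    by (rule that[of "\<lambda>k. real k + 1"]) (simp_all add: C_def True algebra_simps)
next
  case False
  define \<theta> where "\<theta> = pi / real m"
  define a where "a k = sin (real (Suc k) * \<theta>) / sin \<theta>" for k
  have m: "m \<ge> 2"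
    using False assms(1) by simp
  then have "0 < \<theta>" "\<theta> < pi"
    by (simp_all add: \<theta>_def field_simps)
  then have s: "sin \<theta> > 0"
    by (rule sin_gt_zero)
  have C: "C = cos \<theta>"
    using False by (simp add: C_def \<theta>_def)
  show thesis
  proof (rule that[of a])
    show "a 0 = 1" "a (Suc 0) = 2 * C"
      using s by (simp_all add: a_def C sin_double)
    show "a (Suc (Suc k)) = 2 * C * a (Suc k) - a k" for k
    proof -
      define \<gamma> where "\<gamma> = real (Suc (Suc k)) * \<theta>"
      have "real (Suc (Suc (Suc k))) * \<theta> = \<gamma> + \<theta>" "real (Suc k) * \<theta> = \<gamma> - \<theta>"
        by (simp_all add: \<gamma>_def algebra_simps)
      note eqs = this
      show ?thesis
        using s unfolding a_def \<gamma>_def[symmetric] C eqs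
        by (simp add: sin_add sin_diff field_simps)
    qed
    show "0 \<le> a k" if "m = 0 \<or> k < m" for k
    proof -
      have "real (Suc k) * \<theta> \<le> real m * \<theta>"
        using that False \<open>0 < \<theta>\<close> by (intro mult_right_mono) auto
      also have "\<dots> = pi"
        using False by (simp add: \<theta>_def)
      finally have "0 \<le> sin (real (Suc k) * \<theta>)"
        using \<open>0 < \<theta>\<close> by (intro sin_ge_zero) auto
      with s show ?thesis
        by (simp add: a_def)
    qed
  qed
qed

context finite_rank_coxeter
begin

definition nonneg :: "('a \<Rightarrow>\<^sub>0 real) \<Rightarrow> bool" where
  "nonneg v \<longleftrightarrow> (\<forall>s\<in>S. 0 \<le> Poly_Mapping.lookup v s)"

lemma nonneg_combination:
  "nonneg u \<Longrightarrow> nonneg v \<Longrightarrow> 0 \<le> x \<Longrightarrow> 0 \<le> y \<Longrightarrow> nonneg (x *\<^sub>R u + y *\<^sub>R v)"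
  by (simp add: nonneg_def lookup_add)

lemma list_prod_alt_closed:
  "s \<in> S \<Longrightarrow> t \<in> S \<Longrightarrow> list_prod W (alt s t k) \<in> carrier W"
  using set_alt[of s t k] by (intro list_prod_closed) (auto simp: subset_iff)

text \<open>Exchanging the roles of \<open>s\<close> and \<open>t\<close> in an alternating word of length \<open>k\<close> costs a \<open>k\<close>-th power of
  the rotation, which is trivial for \<open>k = m(s, t)\<close>. This gives the braid relation below.\<close>

lemma list_prod_alt_swap:
  assumes "s \<in> S" "t \<in> S"
  shows "list_prod W (alt s t k) =
    ((if even k then s \<otimes> t else t \<otimes> s) [^] k) \<otimes> list_prod W (alt t s k)"
proof (induction k)
  case (Suc k)
  have conj: "x \<otimes> ((y \<otimes> x) [^] n) = ((x \<otimes> y) [^] n) \<otimes> x"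
    if "x \<in> S" "y \<in> S" for x y and n :: nat
  proof (induction n)
    case (Suc n)
    have "x \<otimes> ((y \<otimes> x) [^] Suc n) = (x \<otimes> ((y \<otimes> x) [^] n)) \<otimes> (y \<otimes> x)"
      using that by (simp add: m_assoc)
    also have "\<dots> = ((x \<otimes> y) [^] n) \<otimes> x \<otimes> (y \<otimes> x)"
      by (simp add: Suc.IH)
    also have "\<dots> = ((x \<otimes> y) [^] Suc n) \<otimes> x"
      using that by (simp add: m_assoc)
    finally show ?case .
  qed (use that in simp)
  define x where "x = (if even k then t else s)"
  define y where "y = (if even k then s else t)"
  have xy: "x \<in> S" "y \<in> S"
    using assms by (simp_all add: x_def y_def)
  define P where "P = list_prod W (alt t s k)"
  have P: "P \<in> carrier W"
    using assms by (simp add: P_def list_prod_alt_closed)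
  have IH: "list_prod W (alt s t k) = ((y \<otimes> x) [^] k) \<otimes> P"
    using Suc.IH by (simp add: x_def y_def P_def)
  have "list_prod W (alt s t (Suc k)) = (x \<otimes> ((y \<otimes> x) [^] k)) \<otimes> P"
    using xy P IH by (simp add: x_def m_assoc)
  also have "\<dots> = ((x \<otimes> y) [^] k) \<otimes> x \<otimes> (y \<otimes> (y \<otimes> P))"
    using xy P by (simp add: conj)
  also have "\<dots> = ((x \<otimes> y) [^] Suc k) \<otimes> (y \<otimes> P)"
    using xy P by (simp add: m_assoc)
  also have "\<dots> = ((if even (Suc k) then s \<otimes> t else t \<otimes> s) [^] Suc k) \<otimes> list_prod W (alt t s (Suc k))"
    by (simp add: x_def y_def P_def)
  finally show ?case .
qed simp

lemma braid_relation:
  assumes "s \<in> S" "t \<in> S"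
  shows "list_prod W (alt s t (cox_m W s t)) = list_prod W (alt t s (cox_m W s t))"
proof -
  define m where "m = cox_m W s t"
  have "(s \<otimes> t) [^] m = \<one>"
    using assms pow_ord_eq_1[of "s \<otimes> t"] by (simp add: m_def cox_m_def)
  moreover have "(t \<otimes> s) [^] m = \<one>"
    unfolding m_def cox_m_sym[OF assms] using assms pow_ord_eq_1[of "t \<otimes> s"]
    by (simp add: cox_m_def)
  ultimately show ?thesis
    using list_prod_alt_swap[OF assms, of m] assms
    by (simp add: m_def[symmetric] list_prod_alt_closed)
qed

lemma act_alt_nonneg:
  assumes "s \<in> S" "t \<in> S" "s \<noteq> t" and k: "cox_m W s t = 0 \<or> Suc k < cox_m W s t"
  shows "\<exists>x y. 0 \<le> x \<and> 0 \<le> y \<and>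
    act (list_prod W (alt s t (Suc k))) (\<alpha> s) = x *\<^sub>R \<alpha> s + y *\<^sub>R \<alpha> t"
proof -
  define C where "C = (if cox_m W s t = 0 then 1 else cos (pi / real (cox_m W s t)))"
  obtain a :: "nat \<Rightarrow> real" where a: "a 0 = 1" "a (Suc 0) = 2 * C"
    "\<And>k. a (Suc (Suc k)) = 2 * C * a (Suc k) - a k"
    and a_nonneg: "\<And>k. cox_m W s t = 0 \<or> k < cox_m W s t \<Longrightarrow> 0 \<le> a k"
    using chebyshev_nonneg[OF cox_m_neq_1[OF assms(1-3)]] unfolding C_def by metis
  have C: "B (\<alpha> s) (\<alpha> t) = - C" "B (\<alpha> t) (\<alpha> s) = - C"
    using assms by (simp_all add: B_simple_roots geom_coeff_def C_def cox_m_sym[of t s])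
  define x where "x k = (if even k then t else s)" for k :: nat
  have act_x: "act (x k) v = v - (2 * B (\<alpha> (x k)) v) *\<^sub>R \<alpha> (x k)" for k v
    using assms by (simp add: x_def aff_act_gen aff_refl_def)
  have B_x: "B (\<alpha> (x k)) (\<alpha> (x k)) = 1" "B (\<alpha> (x (Suc k))) (\<alpha> (x k)) = - C" for k
    using assms C by (simp_all add: x_def)
  have "act (list_prod W (alt s t (Suc k))) (\<alpha> s) =
      a (Suc k) *\<^sub>R \<alpha> (x k) + a k *\<^sub>R \<alpha> (x (Suc k))"
  proof (induction k)
    case 0
    have "act (list_prod W (alt s t (Suc 0))) (\<alpha> s) = act (x 0) (\<alpha> s)"
      using assms by (simp add: x_def)
    also have "\<dots> = \<alpha> s + (2 * C) *\<^sub>R \<alpha> t"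
      unfolding act_x by (simp add: x_def C)
    finally show ?case
      by (simp add: a x_def)
  next
    case (Suc k)
    have "act (list_prod W (alt s t (Suc (Suc k)))) (\<alpha> s) =
        act (x (Suc k)) (act (list_prod W (alt s t (Suc k))) (\<alpha> s))"
      using assms list_prod_alt_closed[OF assms(1,2), of "Suc k"]
      by (simp add: x_def aff_act_mult del: alt.simps(2)) (simp add: aff_act_mult list_prod_alt_closed)
    also have "\<dots> = a (Suc k) *\<^sub>R \<alpha> (x k) + a k *\<^sub>R \<alpha> (x (Suc k)) -
        (2 * (a k - C * a (Suc k))) *\<^sub>R \<alpha> (x (Suc k))"
      unfolding Suc.IH act_x by (simp add: B_x algebra_simps)
    also have "\<dots> = a (Suc k) *\<^sub>R \<alpha> (x k) +
        (a k - 2 * (a k - C * a (Suc k))) *\<^sub>R \<alpha> (x (Suc k))"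
      by (simp only: scaleR_diff_left add_diff_eq)
    also have "a k - 2 * (a k - C * a (Suc k)) = a (Suc (Suc k))"
      by (simp add: a(3))
    also have "x k = x (Suc (Suc k))"
      by (simp add: x_def)
    finally show ?case
      by (simp add: add.commute)
  qed
  moreover have "0 \<le> a (Suc k)" "0 \<le> a k"
    using k by (auto intro!: a_nonneg)
  ultimately show ?thesis
    by (intro exI[of _ "if even k then a k else a (Suc k)"]
        exI[of _ "if even k then a (Suc k) else a k"]) (auto simp: x_def simp del: alt.simps)
qed

text \<open>Induction on the length of \<open>w\<close>. A right descent \<open>t\<close> of \<open>w\<close> differs from \<open>s\<close>. Split off from the right
  end of \<open>w\<close> the longest alternating word in \<open>s\<close> and \<open>t\<close> that ends in \<open>t\<close> and shortens \<open>w\<close> by its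
  full length. The remaining factor \<open>v\<close> has neither \<open>s\<close> nor \<open>t\<close> as a descent, so it keeps both
  simple roots nonnegative, and the alternating word sends \<open>\<alpha> s\<close> to a nonnegative combination of
  \<open>\<alpha> s\<close> and \<open>\<alpha> t\<close>, provided that it is shorter than \<open>m(s, t)\<close>. Otherwise the braid relation would
  move an \<open>s\<close> to the end of \<open>w\<close> and make \<open>s\<close> a descent.\<close>

theorem nonneg_of_ascent:
  assumes "w \<in> carrier W" "s \<in> S" "\<not> len (w \<otimes> s) < len w"
  shows "nonneg (act w (\<alpha> s))"
  using assms
proof (induction "len w" arbitrary: w s rule: less_induct)
  case less
  show ?case
  proof (cases "w = \<one>")
    case True
    then show ?thesis
      by (simp add: nonneg_def lookup_simple_root)
  next
    case False
    then obtain t where t: "t \<in> S" "len (w \<otimes> t) < len w"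
      using less.prems(1) cox.right_descent by metis
    with less.prems have st: "s \<noteq> t"
      by auto
    define P where "P k = list_prod W (alt s t k)" for k
    have P_closed [simp]: "P k \<in> carrier W" for k
      using less.prems(2) t(1) by (simp add: P_def list_prod_alt_closed)
    have len_P: "len (P k) \<le> k" for k
      using cox.len_le[of "alt s t k"] set_alt[of s t k] less.prems(2) t(1)
      unfolding P_def by auto
    define Q where "Q k \<longleftrightarrow> (\<exists>v\<in>carrier W. w = v \<otimes> P k \<and> len v + k = len w)" for k
    have "Q 1"
    proof -
      have "w = (w \<otimes> t) \<otimes> P 1"
        using less.prems(1) t(1) by (simp add: P_def m_assoc)
      moreover from this have "len w \<le> len (w \<otimes> t) + 1"
        using cox.len_mult[of "w \<otimes> t" "P 1"] len_P[of 1] less.prems(1) t(1) by simp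
      ultimately show ?thesis
        unfolding Q_def using t less.prems(1) by (intro bexI[of _ "w \<otimes> t"]) auto
    qed
    define k where "k = (GREATEST k. Q k)"
    have Q_bound: "\<forall>k. Q k \<longrightarrow> k \<le> len w"
      by (auto simp: Q_def)
    have "Q k"
      unfolding k_def using \<open>Q 1\<close> Q_bound by (metis GreatestI_nat)
    have k_max: "j \<le> k" if "Q j" for j
      unfolding k_def using that Q_bound by (intro Greatest_le_nat) auto
    obtain v where v: "v \<in> carrier W" "w = v \<otimes> P k" "len v + k = len w"
      using \<open>Q k\<close> by (auto simp: Q_def)
    obtain j where j: "k = Suc j"
      using k_max[OF \<open>Q 1\<close>] by (cases k) auto
    define x where "x = (if even j then t else s)"
    define y where "y = (if even j then s else t)"
    have xy: "x \<in> S" "y \<in> S"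
      using less.prems(2) t(1) by (simp_all add: x_def y_def)
    have P_k: "P k = x \<otimes> P j"
      by (simp add: P_def j x_def)
    have P_Suc_k: "P (Suc k) = y \<otimes> P k"
      by (simp add: P_def j y_def)
    \<comment> \<open>The letter \<open>y\<close> would extend the alternating word, against its maximality.\<close>
    have "\<not> len (v \<otimes> y) < len v"
    proof
      assume lt: "len (v \<otimes> y) < len v"
      have w: "w = (v \<otimes> y) \<otimes> P (Suc k)"
        using v(1,2) xy by (simp add: P_Suc_k m_assoc)
      then have "len w \<le> len (v \<otimes> y) + Suc k"
        using cox.len_mult[of "v \<otimes> y" "P (Suc k)"] len_P[of "Suc k"] v(1) xy by simp
      with w lt v xy have "Q (Suc k)"
        unfolding Q_def by (intro bexI[of _ "v \<otimes> y"]) auto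
      then show False
        using k_max by fastforce
    qed
    \<comment> \<open>The letter \<open>x\<close> would cancel the first letter of the alternating word and make \<open>w\<close> shorter.\<close>
    moreover have "\<not> len (v \<otimes> x) < len v"
    proof
      assume lt: "len (v \<otimes> x) < len v"
      have "w = (v \<otimes> x) \<otimes> P j"
        using v(1,2) xy by (simp add: P_k m_assoc)
      then have "len w \<le> len (v \<otimes> x) + j"
        using cox.len_mult[of "v \<otimes> x" "P j"] len_P[of j] v(1) xy by simp
      with lt v(3) j show False
        by simp
    qed
    moreover have "len v < len w"
      using v(3) j by simp
    ultimately have "nonneg (act v (\<alpha> x))" "nonneg (act v (\<alpha> y))"
      using less.hyps v(1) xy by blast+
    then have nn: "nonneg (act v (\<alpha> s))" "nonneg (act v (\<alpha> t))"
      by (simp_all add: x_def y_def split: if_splits)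
    \<comment> \<open>The alternating word is shorter than \<open>m(s, t)\<close>, or else \<open>s\<close> is a descent of \<open>w\<close>.\<close>
    have bound: "cox_m W s t = 0 \<or> Suc j < cox_m W s t"
    proof (rule ccontr)
      define m where "m = cox_m W s t"
      assume "\<not> (cox_m W s t = 0 \<or> Suc j < cox_m W s t)"
      then have m: "0 < m" "m \<le> k"
        by (simp_all add: m_def j)
      obtain us where us: "length us = k - m" "set us \<subseteq> {s, t}" "alt s t k = us @ alt s t m"
        using alt_add[of "k - m" s t m] m by auto
      have us_S: "set us \<subseteq> S" and us_carrier: "set us \<subseteq> carrier W"
        using us(2) less.prems(2) t(1) by auto
      obtain n where n: "m = Suc n"
        using m by (cases m) auto
      have alt_carrier: "set (alt s t i) \<subseteq> carrier W" for i
        using set_alt[of s t i] less.prems(2) t(1) by auto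
      have "P m = list_prod W (alt t s m)"
        using braid_relation[OF less.prems(2) t(1)] by (simp add: P_def m_def)
      also have "\<dots> = P n \<otimes> s"
        unfolding n alt_snoc P_def using alt_carrier less.prems(2)
        by (subst list_prod_append) auto
      finally have "P k = list_prod W us \<otimes> (P n \<otimes> s)"
        using us(3) us_carrier alt_carrier by (simp add: P_def list_prod_append)
      then have "w \<otimes> s = v \<otimes> (list_prod W us \<otimes> P n)"
        using v(1,2) less.prems(2) us_carrier by (simp add: m_assoc list_prod_closed)
      then have "len (w \<otimes> s) \<le> len v + (len (list_prod W us) + len (P n))"
        using v(1) us_carrier cox.len_mult[of v "list_prod W us \<otimes> P n"]
          cox.len_mult[of "list_prod W us" "P n"] by (simp add: list_prod_closed)
      also have "\<dots> \<le> len v + ((k - m) + n)"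
        using cox.len_le[OF us_S] len_P[of n] us(1) by simp
      also have "\<dots> < len w"
        using v(3) m n by simp
      finally show False
        using less.prems(3) by simp
    qed
    obtain a b where ab: "0 \<le> a" "0 \<le> b" "act (P k) (\<alpha> s) = a *\<^sub>R \<alpha> s + b *\<^sub>R \<alpha> t"
      using act_alt_nonneg[OF less.prems(2) t(1) st bound] unfolding P_def j by blast
    have "act w (\<alpha> s) = a *\<^sub>R act v (\<alpha> s) + b *\<^sub>R act v (\<alpha> t)"
      using v(1) ab(3) act_linear[OF v(1)]
      by (simp add: v(2) aff_act_mult linear_add linear_scale)
    then show ?thesis
      using nonneg_combination[OF nn ab(1,2)] by simp
  qed
qed

lemma nonpos_of_descent:
  assumes "w \<in> carrier W" "s \<in> S" "len (w \<otimes> s) < len w"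
  shows "nonneg (- act w (\<alpha> s))"
proof -
  have w: "w = (w \<otimes> s) \<otimes> s"
    using assms by (simp add: m_assoc)
  then have "nonneg (act (w \<otimes> s) (\<alpha> s))"
    using assms by (intro nonneg_of_ascent) auto
  moreover have "act (w \<otimes> s) (\<alpha> s) = act w (- \<alpha> s)"
    using assms by (simp add: aff_act_mult aff_act_gen aff_refl_def algebra_simps scaleR_2)
  ultimately show ?thesis
    using act_linear[OF assms(1)] by (simp add: linear_neg)
qed

lemma geom_space_support: "v \<in> geom_space S \<Longrightarrow> u \<notin> S \<Longrightarrow> Poly_Mapping.lookup v u = 0"
  unfolding geom_space_def
  by (induction rule: span_induct_alt) (auto simp: lookup_add lookup_simple_root split: if_splits)

lemma simple_root_in_space: "s \<in> S \<Longrightarrow> \<alpha> s \<in> geom_space S"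
  unfolding geom_space_def by (rule span_base) simp

lemma subspace_geom_space: "subspace (geom_space S)"
  by (simp add: geom_space_def)

lemma act_in_space: "w \<in> carrier W \<Longrightarrow> v \<in> geom_space S \<Longrightarrow> act w v \<in> geom_space S"
proof (induction arbitrary: v rule: carrier_induct)
  case (mult s w)
  then show ?case
    using subspace_diff[OF subspace_geom_space] subspace_scale[OF subspace_geom_space]
      simple_root_in_space
    by (simp add: aff_act_mult) (simp add: aff_act_gen aff_refl_def)
qed simp

text \<open>A descent of \<open>w\<close> sends its simple root to the negative side, so the identity has none.\<close>

lemma faithful_one:
  assumes "w \<in> carrier W" "\<And>v. v \<in> geom_space S \<Longrightarrow> act w v = v"
  shows "w = \<one>"
proof (rule ccontr)
  assume "w \<noteq> \<one>"
  then obtain s where s: "s \<in> S" "len (w \<otimes> s) < len w"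
    using assms(1) cox.right_descent by metis
  then have "nonneg (- \<alpha> s)"
    using nonpos_of_descent[OF assms(1) s] assms(2) simple_root_in_space by simp
  with s show False
    by (auto simp: nonneg_def lookup_simple_root)
qed

lemma faithful:
  assumes "u \<in> carrier W" "w \<in> carrier W"
    and "\<And>v. v \<in> geom_space S \<Longrightarrow> act u v = act w v"
  shows "u = w"
proof -
  have "act (inv u \<otimes> w) v = v" if "v \<in> geom_space S" for v
    using assms that aff_act_inv[of "inv u"] by (simp add: aff_act_mult flip: assms(3))
  then have "inv u \<otimes> w = \<one>"
    using assms by (intro faithful_one) auto
  then show ?thesis
    using assms by (metis inv_closed inv_equality inv_inv inv_comm)
qed

lemma nonneg_antisym:
  assumes "nonneg v" "nonneg (- v)" "v \<in> geom_space S"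
  shows "v = 0"
proof (rule poly_mapping_eqI)
  fix u
  show "Poly_Mapping.lookup v u = Poly_Mapping.lookup 0 u"
    using assms geom_space_support[of v u] by (cases "u \<in> S") (force simp: nonneg_def)+
qed


section \<open>Reflections and their roots\<close>

abbreviation T :: "'a set" where
  "T \<equiv> reflections W S"

abbreviation rfl :: "('a \<Rightarrow>\<^sub>0 real) \<Rightarrow> ('a \<Rightarrow>\<^sub>0 real) \<Rightarrow> ('a \<Rightarrow>\<^sub>0 real)" where
  "rfl \<equiv> geom_reflection W S"

abbreviation \<rho> :: "'a \<Rightarrow> ('a \<Rightarrow>\<^sub>0 real)" where
  "\<rho> \<equiv> refl_root W S"

lemma aff_refl_zero: "aff_refl (\<lambda>_. 0) = rfl"
  by (simp add: fun_eq_iff aff_refl_def geom_reflection_def)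

lemma linear_zero_functional: "linear (\<lambda>_::'a \<Rightarrow>\<^sub>0 real. 0::real)"
  by (rule linearI) simp_all

lemma rfl_involution: "B \<beta> \<beta> = 1 \<Longrightarrow> rfl \<beta> (rfl \<beta> v) = v"
  by (simp add: geom_reflection_def algebra_simps)

lemma rfl_in_space: "\<beta> \<in> geom_space S \<Longrightarrow> v \<in> geom_space S \<Longrightarrow> rfl \<beta> v \<in> geom_space S"
  using subspace_diff[OF subspace_geom_space] subspace_scale[OF subspace_geom_space]
  by (simp add: geom_reflection_def)

lemma rfl_eq_imp:
  assumes "\<beta> \<in> geom_space S" "B \<beta> \<beta> = 1" "B \<gamma> \<gamma> = 1"
    and "\<And>v. v \<in> geom_space S \<Longrightarrow> rfl \<beta> v = rfl \<gamma> v"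
  shows "\<gamma> = \<beta> \<or> \<gamma> = - \<beta>"
proof -
  define k where "k = B \<gamma> \<beta>"
  have "rfl \<beta> \<beta> = rfl \<gamma> \<beta>"
    using assms(1,4) by blast
  then have "2 *\<^sub>R \<beta> = 2 *\<^sub>R (k *\<^sub>R \<gamma>)"
    using assms(2) by (simp add: geom_reflection_def k_def)
  then have \<beta>: "\<beta> = k *\<^sub>R \<gamma>"
    by (simp only: scaleR_cancel_left) simp
  then have "k * k = 1"
    using assms(2,3) by simp
  then have "k = 1 \<or> k = - 1"
    by (simp add: square_eq_1_iff)
  then show ?thesis
    using \<beta> by auto
qed

lemma reflections_closed: "T \<subseteq> carrier W"
  by (auto simp: reflections_def)

lemma reflectionE:
  assumes "t \<in> T"
  obtains w s where "w \<in> carrier W" "s \<in> S" "t = w \<otimes> s \<otimes> inv w"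
  using assms unfolding reflections_def by blast

lemma reflection_carrier [simp]: "t \<in> T \<Longrightarrow> t \<in> carrier W"
  using reflections_closed by auto

lemma S_subset_reflections: "S \<subseteq> T"
proof
  fix s assume "s \<in> S"
  then have "s = \<one> \<otimes> s \<otimes> inv \<one>"
    by simp
  with \<open>s \<in> S\<close> show "s \<in> T"
    unfolding reflections_def by blast
qed

lemma reflection_conj:
  assumes "w \<in> carrier W" "t \<in> T"
  shows "w \<otimes> t \<otimes> inv w \<in> T"
proof -
  obtain u s where us: "u \<in> carrier W" "s \<in> S" "t = u \<otimes> s \<otimes> inv u"
    using assms(2) by (rule reflectionE)
  have "inv (w \<otimes> u) = inv u \<otimes> inv w"
    using us assms(1) by (intro inv_mult_group) auto
  then have "w \<otimes> t \<otimes> inv w = (w \<otimes> u) \<otimes> s \<otimes> inv (w \<otimes> u)"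
    using us assms(1) by (simp add: m_assoc)
  then show ?thesis
    using us assms(1) unfolding reflections_def by blast
qed

lemma reflection_square [simp]:
  assumes "t \<in> T"
  shows "t \<otimes> t = \<one>"
proof -
  obtain w s where ws: "w \<in> carrier W" "s \<in> S" "t = w \<otimes> s \<otimes> inv w"
    using assms by (rule reflectionE)
  have "inv w \<otimes> (w \<otimes> (s \<otimes> inv w)) = s \<otimes> inv w"
    using ws by (simp flip: m_assoc)
  with ws show ?thesis
    by (simp add: m_assoc)
qed

lemma reflection_inv [simp]: "t \<in> T \<Longrightarrow> inv t = t"
  by (simp add: inv_equality)

lemma reflection_cancel [simp]: "t \<in> T \<Longrightarrow> w \<in> carrier W \<Longrightarrow> t \<otimes> (t \<otimes> w) = w"
  by (simp flip: m_assoc)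

lemma reflection_conj_reflection: "t \<in> T \<Longrightarrow> u \<in> T \<Longrightarrow> t \<otimes> u \<otimes> t \<in> T"
  using reflection_conj[of t u] by simp

sublocale refl: involution_generated W T
proof
  show "T \<subseteq> carrier W"
    by (rule reflections_closed)
  show "inv t = t" if "t \<in> T" for t
    using that by simp
  have "carrier W \<subseteq> generate W T"
    using mono_generate[OF S_subset_reflections] cox.gens_generate by simp
  then show "generate W T = carrier W"
    using generate_incl[OF reflections_closed] by blast
qed

lemma root_positive_or_negative:
  "w \<in> carrier W \<Longrightarrow> s \<in> S \<Longrightarrow> nonneg (act w (\<alpha> s)) \<or> nonneg (- act w (\<alpha> s))"
  using nonneg_of_ascent nonpos_of_descent by blast

lemma root_systemI: "w \<in> carrier W \<Longrightarrow> s \<in> S \<Longrightarrow> act w (\<alpha> s) \<in> root_system W S"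
  unfolding root_system_def by (intro CollectI exI[of _ w] exI[of _ s]) (simp add: geom_act_eq)

lemma root_systemE:
  assumes "\<beta> \<in> root_system W S"
  shows "\<beta> \<in> geom_space S" "B \<beta> \<beta> = 1"
  using assms by (auto simp: root_system_def geom_act_eq act_B act_in_space simple_root_in_space)

text \<open>For \<open>t = w s w\<inverse>\<close> the root is \<open>w (\<alpha> s)\<close> up to sign, and the sign is decided by positivity. The
  formula for all functionals \<open>f\<close> at once keeps track of the root even along vectors in the radical
  of \<open>B\<close>.\<close>

lemma refl_root_correct:
  assumes "t \<in> T"
  shows "\<rho> t \<in> positive_roots W S"
    and "\<And>f. linear f \<Longrightarrow> aff_act f t = aff_refl f (\<rho> t)"
proof -
  obtain w s where ws: "w \<in> carrier W" "s \<in> S" "t = w \<otimes> s \<otimes> inv w"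
    using assms by (rule reflectionE)
  define \<gamma> where "\<gamma> = act w (\<alpha> s)"
  define \<beta> where "\<beta> = (if nonneg \<gamma> then \<gamma> else - \<gamma>)"
  have "\<gamma> \<in> root_system W S"
    using ws by (simp add: \<gamma>_def root_systemI)
  moreover have "- \<gamma> = act (w \<otimes> s) (\<alpha> s)"
    using ws linear_neg[OF act_linear[OF ws(1)]]
    by (simp add: aff_act_mult \<gamma>_def aff_act_gen aff_refl_def algebra_simps scaleR_2)
  then have "- \<gamma> \<in> root_system W S"
    using ws by (simp add: root_systemI)
  ultimately have \<beta>_root: "\<beta> \<in> root_system W S"
    by (simp add: \<beta>_def)
  have "nonneg \<beta>"
    using root_positive_or_negative[OF ws(1,2)] by (auto simp: \<beta>_def \<gamma>_def)
  with \<beta>_root have \<beta>_pos: "\<beta> \<in> positive_roots W S"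
    by (simp add: positive_roots_def nonneg_def)
  have aff: "aff_act f t = aff_refl f \<beta>" if "linear f" for f
  proof -
    have "aff_refl f (- \<gamma>) = aff_refl f \<gamma>"
      using that by (simp add: fun_eq_iff aff_refl_def linear_neg algebra_simps)
    then show ?thesis
      using aff_act_conj[OF that ws(1,2)] ws(3) by (simp add: \<beta>_def \<gamma>_def)
  qed
  have act_t: "geom_act W S t v = rfl \<beta> v" for v
    using aff[OF linear_zero_functional] assms by (simp add: geom_act_eq aff_refl_zero)
  have "\<rho> t = \<beta>"
    unfolding refl_root_def
  proof (rule the_equality)
    show "\<beta> \<in> positive_roots W S \<and> (\<forall>v\<in>geom_space S. geom_act W S t v = rfl \<beta> v)"
      using \<beta>_pos act_t by blast
    fix \<delta>
    assume \<delta>: "\<delta> \<in> positive_roots W S \<and> (\<forall>v\<in>geom_space S. geom_act W S t v = rfl \<delta> v)"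
    have \<delta>_root: "\<delta> \<in> root_system W S" and \<delta>_nonneg: "nonneg \<delta>"
      using \<delta> by (auto simp: positive_roots_def nonneg_def)
    have "\<delta> = \<beta> \<or> \<delta> = - \<beta>"
      using \<delta> act_t by (intro rfl_eq_imp) (auto intro: root_systemE \<beta>_root \<delta>_root)
    then show "\<delta> = \<beta>"
    proof
      assume "\<delta> = - \<beta>"
      then have "\<beta> = 0"
        using \<delta>_nonneg \<open>nonneg \<beta>\<close> root_systemE(1)[OF \<beta>_root] nonneg_antisym by simp
      with root_systemE(2)[OF \<beta>_root] show ?thesis
        by simp
    qed
  qed
  then show "\<rho> t \<in> positive_roots W S" "\<And>f. linear f \<Longrightarrow> aff_act f t = aff_refl f (\<rho> t)"
    using \<beta>_pos aff by simp_all
qed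

lemma refl_root_in_space: "t \<in> T \<Longrightarrow> \<rho> t \<in> geom_space S"
  and refl_root_norm [simp]: "t \<in> T \<Longrightarrow> B (\<rho> t) (\<rho> t) = 1"
  using refl_root_correct(1) root_systemE by (auto simp: positive_roots_def)

lemma act_reflection: "t \<in> T \<Longrightarrow> act t = rfl (\<rho> t)"
  using refl_root_correct(2)[OF _ linear_zero_functional] by (simp add: aff_refl_zero)

lemma reflection_not_one: "t \<in> T \<Longrightarrow> t \<noteq> \<one>"
proof
  assume t: "t \<in> T" "t = \<one>"
  then have "rfl (\<rho> t) (\<rho> t) = \<rho> t"
    using act_reflection[OF t(1)] by simp
  then have "\<rho> t = 0"
    using t by (simp add: geom_reflection_def)
  then show False
    using refl_root_norm[OF t(1)] by simp
qed

lemma refl_root_proportional: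
  assumes "t \<in> T" "u \<in> T" "\<rho> t = k *\<^sub>R \<rho> u"
  shows "t = u"
proof -
  have k: "k * k = 1"
    using refl_root_norm[OF assms(1)] refl_root_norm[OF assms(2)] assms(3) by simp
  have "act t v = act u v" for v
  proof -
    have "rfl (\<rho> t) v = v - (k * k) *\<^sub>R ((2 * B (\<rho> u) v) *\<^sub>R \<rho> u)"
      unfolding assms(3) by (simp add: geom_reflection_def algebra_simps)
    then show ?thesis
      using assms by (simp add: act_reflection k geom_reflection_def)
  qed
  then show ?thesis
    using assms by (intro faithful) auto
qed

lemma refl_roots_independent:
  assumes "t \<in> T" "u \<in> T" "t \<noteq> u"
  shows "independent {\<rho> t, \<rho> u}" "\<rho> t \<noteq> \<rho> u"
proof -
  show "\<rho> t \<noteq> \<rho> u"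
    using refl_root_proportional[OF assms(1,2), of 1] assms(3) by auto
  have "\<rho> u \<noteq> 0"
    using refl_root_norm[OF assms(2)] by auto
  then show "independent {\<rho> t, \<rho> u}"
    using refl_root_proportional[OF assms(1,2)] assms(3)
    by (auto simp: independent_insert span_singleton)
qed

text \<open>Induction on the length of \<open>g\<close>, by conjugation with a right descent \<open>s\<close>. The vector \<open>u = g (\<alpha> s)\<close> is
  nonpositive. If \<open>u = - \<alpha> s\<close>, then \<open>d\<close> is proportional to \<open>\<alpha> s\<close> and \<open>g = s\<close> by faithfulness.
  Otherwise \<open>s g s\<close> is shorter than \<open>g\<close>: applying \<open>s\<close> to \<open>u\<close> changes only the coefficient of \<open>\<alpha> s\<close>,
  so that \<open>s u\<close> could be nonnegative only if \<open>u\<close> were a multiple of \<open>\<alpha> s\<close>. Being conjugate to \<open>g\<close>,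
  the element \<open>s g s\<close> again acts as a linear reflection.\<close>

theorem reflection_of_linear_reflection:
  assumes "g \<in> carrier W" "d \<in> geom_space S" "B d d = 1"
    and "\<And>v. v \<in> geom_space S \<Longrightarrow> act g v = rfl d v"
  shows "g \<in> T"
  using assms
proof (induction "len g" arbitrary: g d rule: less_induct)
  case less
  note g = less.prems(1) and d = less.prems(2,3) and act_g = less.prems(4)
  have "g \<noteq> \<one>"
  proof
    assume "g = \<one>"
    then have "rfl d d = d"
      using act_g[OF d(1)] by simp
    then have "d = 0"
      using d(2) by (simp add: geom_reflection_def)
    with d(2) show False
      by simp
  qed
  then obtain s where s: "s \<in> S" "len (g \<otimes> s) < len g"
    using g cox.right_descent by metis
  have act_s: "act s = rfl (\<alpha> s)"
    using s by (simp add: aff_act_gen aff_refl_zero)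
  define u where "u = act g (\<alpha> s)"
  have u_space: "u \<in> geom_space S"
    using g s by (simp add: u_def act_in_space simple_root_in_space)
  have u_neg: "nonneg (- u)"
    unfolding u_def using g s by (rule nonpos_of_descent)
  show ?case
  proof (cases "u = - \<alpha> s")
    case True
    define k where "k = B d (\<alpha> s)"
    have "- \<alpha> s = \<alpha> s - (2 * k) *\<^sub>R d"
      using True act_g[OF simple_root_in_space[OF s(1)]]
      by (simp add: u_def geom_reflection_def k_def)
    then have "2 *\<^sub>R \<alpha> s = 2 *\<^sub>R (k *\<^sub>R d)"
      by (simp add: scaleR_2 algebra_simps)
    then have \<alpha>: "\<alpha> s = k *\<^sub>R d"
      by (simp only: scaleR_cancel_left) simp
    then have k: "k * k = 1"
      using B_simple_root_self[OF s(1)] d(2) by simp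
    have "rfl (\<alpha> s) v = v - (k * k) *\<^sub>R ((2 * B d v) *\<^sub>R d)" for v
      unfolding \<alpha> by (simp add: geom_reflection_def algebra_simps)
    then have "rfl (\<alpha> s) v = rfl d v" for v
      by (simp add: k geom_reflection_def)
    then have "g = s"
      using g s act_g act_s by (intro faithful) auto
    then show ?thesis
      using s S_subset_reflections by auto
  next
    case False
    have "act (g \<otimes> g) v = v" if "v \<in> geom_space S" for v
      using g d act_g that by (simp add: aff_act_mult rfl_in_space rfl_involution)
    then have "g \<otimes> g = \<one>"
      using g by (intro faithful_one) auto
    then have "inv g = g"
      using g by (simp add: inv_equality)
    then have "s \<otimes> g = inv (g \<otimes> s)"
      using g s by (simp add: inv_mult_group)
    then have sg: "len (s \<otimes> g) < len g"
      using s g by (simp add: cox.len_inv)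
    define g' where "g' = s \<otimes> g \<otimes> s"
    have "len g' < len g"
    proof (rule ccontr)
      assume "\<not> len g' < len g"
      then have "nonneg (act (s \<otimes> g) (\<alpha> s))"
        using sg g s by (intro nonneg_of_ascent) (auto simp: g'_def)
      then have u_pos: "nonneg (rfl (\<alpha> s) u)"
        using g s by (simp add: aff_act_mult act_s u_def)
      have "u = Poly_Mapping.lookup u s *\<^sub>R \<alpha> s"
      proof (rule poly_mapping_eqI)
        fix r
        show "Poly_Mapping.lookup u r = Poly_Mapping.lookup (Poly_Mapping.lookup u s *\<^sub>R \<alpha> s) r"
        proof (cases "r \<in> S \<and> r \<noteq> s")
          case True
          then have "0 \<le> Poly_Mapping.lookup u r" "0 \<le> - Poly_Mapping.lookup u r"
            using u_pos u_neg
            by (auto simp: nonneg_def geom_reflection_def lookup_minus lookup_simple_root)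
          with True show ?thesis
            by (simp add: lookup_simple_root)
        next
          case False
          then have "r = s \<or> Poly_Mapping.lookup u r = 0"
            using geom_space_support[OF u_space] by blast
          with False s show ?thesis
            by (cases "r = s") (simp_all add: lookup_simple_root)
        qed
      qed
      moreover define k where "k = Poly_Mapping.lookup u s"
      ultimately have u: "u = k *\<^sub>R \<alpha> s"
        by simp
      have "B u u = 1"
        using g s by (simp add: u_def act_B)
      then have "k * k = 1"
        using s by (simp add: u)
      moreover have "k \<le> 0"
        using u_neg s by (simp add: k_def nonneg_def)
      ultimately have "k = - 1"
        by (auto simp: square_eq_1_iff)
      with u False show False
        by simp
    qed
    moreover have "g' \<in> carrier W"
      using g s by (simp add: g'_def)
    moreover have "act s d \<in> geom_space S" "B (act s d) (act s d) = 1"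
      using d s by (simp_all add: act_in_space act_B)
    moreover have "act g' v = rfl (act s d) v" if v: "v \<in> geom_space S" for v
    proof -
      have "act s (act s v) = v"
        using s aff_act_inv[of s] by simp
      have "act g' v = act s (rfl d (act s v))"
        using g s v act_in_space[of s v] act_g by (simp add: g'_def aff_act_mult)
      also have "\<dots> = act s (act s v) - (2 * B d (act s v)) *\<^sub>R act s d"
        using act_linear[of s] s by (simp add: geom_reflection_def linear_diff linear_scale)
      also have "B d (act s v) = B (act s d) v"
        using act_B[of s d "act s v"] s \<open>act s (act s v) = v\<close> by simp
      finally show ?thesis
        using \<open>act s (act s v) = v\<close> by (simp add: geom_reflection_def)
    qed
    ultimately have "g' \<in> T"
      by (rule less.hyps)
    then have "s \<otimes> g' \<otimes> s \<in> T"
      using s S_subset_reflections by (intro reflection_conj_reflection) auto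
    then show ?thesis
      using g s by (simp add: g'_def m_assoc)
  qed
qed

section \<open>Coplanar reflections\<close>

text \<open>The vector is \<open>d = B a b c + B b c a - B a c b\<close>, which is the product of \<open>a\<close>, \<open>b\<close> and \<open>c\<close> in the
  Clifford algebra of the plane: there a product of three vectors is a vector, and composing
  reflections amounts to conjugating by such products. The identities hold modulo \<open>B c c = 1\<close>.\<close>

lemma triple_linear_reflection:
  assumes "B a a = 1" "B b b = 1" "B c c = 1" and c: "c = x *\<^sub>R a + y *\<^sub>R b"
  defines "d \<equiv> (2 * x * B a b + y) *\<^sub>R a - x *\<^sub>R b"
  shows "B d d = 1" "rfl a (rfl b (rfl c v)) = rfl d v"
proof -
  define p where "p = B a b"
  have p: "B b a = p"
    by (simp add: p_def B_sym[of b a])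
  \<comment> \<open>The norm of \<open>c\<close>, the only relation between the coordinates.\<close>
  have n: "x * x + y * y + 2 * (x * y * p) = 1"
    using assms(1-3) p by (simp add: c p_def[symmetric] algebra_simps)
  have "B d d = x * x + y * y + 2 * (x * y * p)"
    using assms(1,2) p by (simp add: d_def p_def[symmetric] algebra_simps)
  then show "B d d = 1"
    using n by simp
  define q r where "q = B a v" and "r = B b v"
  define e where "e = x * q + y * r"
  define f where "f = r - 2 * e * (x * p + y)"
  define g where "g = q - 2 * e * (x + y * p) - 2 * f * p"
  have 1: "rfl c v = v - (2 * e) *\<^sub>R c"
    by (simp add: geom_reflection_def c e_def q_def r_def)
  have "B b (rfl c v) = f"
    unfolding 1 using assms(2) p by (simp add: c f_def r_def algebra_simps)
  then have 2: "rfl b (rfl c v) = v - (2 * e) *\<^sub>R c - (2 * f) *\<^sub>R b"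
    unfolding 1 by (simp add: geom_reflection_def)
  have "B a (rfl b (rfl c v)) = g"
    unfolding 2 using assms(1) p by (simp add: c g_def q_def p_def[symmetric] algebra_simps)
  then have 3: "rfl a (rfl b (rfl c v)) = v - (2 * e) *\<^sub>R c - (2 * f) *\<^sub>R b - (2 * g) *\<^sub>R a"
    unfolding 2 by (simp add: geom_reflection_def)
  define h where "h = (2 * x * p + y) * q - x * r"
  have "B d v = h"
    by (simp add: d_def h_def p_def q_def r_def)
  then have 4: "rfl d v = v - ((2 * h * (2 * x * p + y)) *\<^sub>R a - (2 * h * x) *\<^sub>R b)"
    unfolding geom_reflection_def d_def p_def[symmetric] by (simp add: scaleR_diff_right)
  have "e * x + g = h * (2 * x * p + y)" "e * y + f = - (h * x)"
  proof -
    have "e * x + g - h * (2 * x * p + y) =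
        (q - 2 * p * r) * (1 - (x * x + y * y + 2 * (x * y * p)))"
      unfolding g_def f_def e_def h_def by (simp add: algebra_simps)
    with n show "e * x + g = h * (2 * x * p + y)"
      by simp
    have "e * y + f + h * x = r * (1 - (x * x + y * y + 2 * (x * y * p)))"
      unfolding f_def e_def h_def by (simp add: algebra_simps)
    with n show "e * y + f = - (h * x)"
      by simp
  qed
  then have "2 * e * x + 2 * g = 2 * h * (2 * x * p + y)" "2 * e * y + 2 * f = - (2 * h * x)"
    by (simp_all add: algebra_simps)
  moreover have "rfl a (rfl b (rfl c v)) =
      v - (2 * e * x + 2 * g) *\<^sub>R a - (2 * e * y + 2 * f) *\<^sub>R b"
    by (subst 3, subst c) (simp add: algebra_simps)
  ultimately show "rfl a (rfl b (rfl c v)) = rfl d v"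
    unfolding 4 by (simp add: diff_diff_eq2)
qed

lemma span_pair_eq:
  fixes a b x y :: "'v::real_vector"
  assumes "independent {x, y}" "x \<noteq> y" "{x, y} \<subseteq> span {a, b}"
  shows "span {x, y} = span {a, b}"
proof -
  have "z \<in> span {x, y}" if z: "z \<in> span {a, b}" for z
  proof (rule ccontr)
    assume z': "z \<notin> span {x, y}"
    then have "independent (insert z {x, y})"
      using assms(1) by (rule independent_insertI)
    moreover have "insert z {x, y} \<subseteq> span {a, b}"
      using z assms(3) by simp
    ultimately have "card (insert z {x, y}) \<le> card {a, b}"
      using independent_span_bound[of "{a, b}"] by blast
    moreover have "z \<notin> {x, y}"
      using z' span_superset by blast
    ultimately show False
      using assms(2) by (auto simp: card_insert_if split: if_splits)
  qed
  then show ?thesis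
    using span_minimal[OF assms(3) subspace_span] by blast
qed

text \<open>Two distinct reflections already span the plane, so the third root is a combination of their roots
  and the linear algebra of \<open>triple_linear_reflection\<close> applies.\<close>

theorem coplanar_triple_reflection:
  assumes T: "t1 \<in> T" "t2 \<in> T" "t3 \<in> T"
    and P: "\<rho> t1 \<in> span {a, b}" "\<rho> t2 \<in> span {a, b}" "\<rho> t3 \<in> span {a, b}"
  shows "t1 \<otimes> t2 \<otimes> t3 \<in> T" "\<rho> (t1 \<otimes> t2 \<otimes> t3) \<in> span {a, b}"
proof -
  have "t1 \<otimes> t2 \<otimes> t3 \<in> T \<and> \<rho> (t1 \<otimes> t2 \<otimes> t3) \<in> span {a, b}"
  proof (cases "t1 = t2")
    case True
    then show ?thesis
      using T P by simp
  next
    case False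
    have "span {\<rho> t1, \<rho> t2} = span {a, b}"
      using refl_roots_independent[OF T(1,2) False] P by (intro span_pair_eq) auto
    with P(3) have "\<rho> t3 \<in> span {\<rho> t1, \<rho> t2}"
      by simp
    then obtain x y where xy: "\<rho> t3 = x *\<^sub>R \<rho> t1 + y *\<^sub>R \<rho> t2"
      by (auto simp: span_breakdown_eq span_singleton algebra_simps)
    define d where "d = (2 * x * B (\<rho> t1) (\<rho> t2) + y) *\<^sub>R \<rho> t1 - x *\<^sub>R \<rho> t2"
    define g where "g = t1 \<otimes> t2 \<otimes> t3"
    have g: "g \<in> carrier W"
      using T by (simp add: g_def)
    have d_norm: "B d d = 1" and "\<And>v. rfl (\<rho> t1) (rfl (\<rho> t2) (rfl (\<rho> t3) v)) = rfl d v"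
      using triple_linear_reflection[OF _ _ _ xy] T unfolding d_def by auto
    then have act_g: "act g v = rfl d v" for v
      using T by (simp add: g_def aff_act_mult act_reflection)
    have d_space: "d \<in> geom_space S"
      unfolding d_def using T subspace_geom_space
      by (intro subspace_diff subspace_scale) (auto intro: refl_root_in_space)
    have d_P: "d \<in> span {a, b}"
      unfolding d_def using P by (intro span_diff span_scale)
    have "g \<in> T"
      using g d_space d_norm act_g by (rule reflection_of_linear_reflection)
    moreover have "\<rho> g = d \<or> \<rho> g = - d"
      using d_space d_norm refl_root_norm[OF \<open>g \<in> T\<close>] act_g act_reflection[OF \<open>g \<in> T\<close>]
      by (intro rfl_eq_imp) auto
    ultimately show ?thesis
      using d_P span_neg[OF d_P] by (auto simp: g_def)
  qed
  then show "t1 \<otimes> t2 \<otimes> t3 \<in> T" "\<rho> (t1 \<otimes> t2 \<otimes> t3) \<in> span {a, b}"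
    by auto
qed

text \<open>Choose the functional \<open>f\<close> to be 1 on \<open>\<rho> t3\<close> and 0 on \<open>\<rho> t4\<close>. In the corresponding affine action
  \<open>t4\<close> fixes the origin and \<open>t3\<close> moves it to \<open>- 2 (\<rho> t3)\<close>, while \<open>t1 t2\<close> moves it within the span
  of \<open>\<rho> t1\<close> and \<open>\<rho> t2\<close>.\<close>

theorem root_of_factor_in_plane:
  assumes T: "t1 \<in> T" "t2 \<in> T" "t3 \<in> T" "t4 \<in> T" and "t3 \<noteq> t4" "t3 \<otimes> t4 = t1 \<otimes> t2"
  shows "\<rho> t3 \<in> span {\<rho> t1, \<rho> t2}"
proof -
  obtain f :: "('a \<Rightarrow>\<^sub>0 real) \<Rightarrow> real" where f: "linear f"
    "\<forall>x\<in>{\<rho> t3, \<rho> t4}. f x = (if x = \<rho> t3 then 1 else 0)"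
    using linear_independent_extend[OF refl_roots_independent(1)[OF T(3,4) assms(5)],
        of "\<lambda>x. if x = \<rho> t3 then 1 else 0"] by blast
  have "f (\<rho> t3) = 1" "f (\<rho> t4) = 0"
    using f(2) refl_roots_independent(2)[OF T(3,4) assms(5)] by auto
  then have "aff_act f (t3 \<otimes> t4) 0 = (- 2) *\<^sub>R \<rho> t3"
    using T f(1) by (simp add: aff_act_mult refl_root_correct(2) aff_refl_def)
  moreover have "aff_act f (t1 \<otimes> t2) 0 \<in> span {\<rho> t1, \<rho> t2}"
    using T f(1) by (simp add: aff_act_mult refl_root_correct(2) aff_refl_def)
      (intro span_diff span_neg span_scale span_base, simp_all)
  ultimately have "(- 1 / 2) *\<^sub>R ((- 2) *\<^sub>R \<rho> t3) \<in> span {\<rho> t1, \<rho> t2}"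
    using assms(6) by (metis span_scale)
  then show ?thesis
    by simp
qed


section \<open>The absolute order\<close>

abbreviation rlen :: "'a \<Rightarrow> nat" where
  "rlen \<equiv> word_length W T"

abbreviation le_T :: "'a \<Rightarrow> 'a \<Rightarrow> bool" (infix "\<preceq>" 50) where
  "u \<preceq> v \<equiv> abs_le W S u v"

lemma refl_length_eq: "refl_length W S = rlen"
  by (simp add: fun_eq_iff refl_length_def word_length_def)

lemma abs_le_iff: "u \<preceq> v \<longleftrightarrow> rlen u + rlen (inv u \<otimes> v) = rlen v"
  by (simp add: abs_le_def refl_length_eq)

lemma rlen_reflection: "t \<in> T \<Longrightarrow> rlen t = 1"
  using refl.len_gen[of t] refl.len_0_iff[of t] reflection_not_one[of t] by fastforce

lemma abs_le_refl: "u \<in> carrier W \<Longrightarrow> u \<preceq> u"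
  by (simp add: abs_le_iff)

lemma abs_le_one: "u \<in> carrier W \<Longrightarrow> \<one> \<preceq> u"
  by (simp add: abs_le_iff)

lemma abs_le_rlen: "u \<preceq> v \<Longrightarrow> rlen u \<le> rlen v"
  by (simp add: abs_le_iff)

lemma abs_le_eqI:
  assumes "u \<in> carrier W" "v \<in> carrier W" "u \<preceq> v" "rlen v \<le> rlen u"
  shows "u = v"
proof -
  have "rlen (inv u \<otimes> v) = 0"
    using assms(3,4) by (simp add: abs_le_iff)
  then have "inv u \<otimes> v = \<one>"
    using assms(1,2) by (simp add: refl.len_0_iff)
  then show ?thesis
    using assms(1,2) by (metis inv_closed inv_equality inv_inv inv_comm)
qed

lemma abs_le_antisym:
  "u \<in> carrier W \<Longrightarrow> v \<in> carrier W \<Longrightarrow> u \<preceq> v \<Longrightarrow> v \<preceq> u \<Longrightarrow> u = v"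
  by (intro abs_le_eqI abs_le_rlen)

lemma abs_le_trans:
  assumes "u \<in> carrier W" "v \<in> carrier W" "w \<in> carrier W" "u \<preceq> v" "v \<preceq> w"
  shows "u \<preceq> w"
proof -
  have "inv u \<otimes> w = (inv u \<otimes> v) \<otimes> (inv v \<otimes> w)"
  proof -
    have "v \<otimes> (inv v \<otimes> w) = w"
      using assms by (simp flip: m_assoc)
    then show ?thesis
      using assms by (simp add: m_assoc)
  qed
  then have "rlen (inv u \<otimes> w) \<le> rlen (inv u \<otimes> v) + rlen (inv v \<otimes> w)"
    using assms refl.len_mult[of "inv u \<otimes> v" "inv v \<otimes> w"] by simp
  moreover have "w = u \<otimes> (inv u \<otimes> w)"
    using assms by (simp flip: m_assoc)
  then have "rlen w \<le> rlen u + rlen (inv u \<otimes> w)"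
    using assms refl.len_mult[of u "inv u \<otimes> w"] by simp
  ultimately show ?thesis
    using assms(4,5) by (simp add: abs_le_iff)
qed

lemma reflection_abs_leI:
  assumes "t \<in> T" "w \<in> carrier W" "Suc (rlen (t \<otimes> w)) \<le> rlen w"
  shows "t \<preceq> w"
proof -
  have "rlen w \<le> 1 + rlen (t \<otimes> w)"
    using assms refl.len_mult[of t "t \<otimes> w"] by (simp add: rlen_reflection)
  with assms show ?thesis
    by (simp add: abs_le_iff rlen_reflection)
qed

lemma reflection_abs_leD:
  "t \<in> T \<Longrightarrow> t \<preceq> w \<Longrightarrow> Suc (rlen (t \<otimes> w)) = rlen w"
  by (simp add: abs_le_iff rlen_reflection)

lemma rlen_2E:
  assumes "w \<in> carrier W" "rlen w = 2"
  obtains t1 t2 where "t1 \<in> T" "t2 \<in> T" "w = t1 \<otimes> t2" "t1 \<noteq> t2"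
proof -
  obtain ts where ts: "set ts \<subseteq> T" "list_prod W ts = w" "length ts = 2"
    using refl.minimal_word[OF assms(1)] assms(2) by metis
  then obtain t1 t2 where t: "ts = [t1, t2]" "t1 \<in> T" "t2 \<in> T"
    by (auto simp: length_Suc_conv numeral_2_eq_2)
  then have "w = t1 \<otimes> t2"
    using ts(2) by simp
  moreover have "t1 \<noteq> t2"
    using t assms(2) \<open>w = t1 \<otimes> t2\<close> by auto
  ultimately show thesis
    using t that by blast
qed

lemma rlen_3E:
  assumes "w \<in> carrier W" "rlen w = 3"
  obtains t1 t2 t3 where "t1 \<in> T" "t2 \<in> T" "t3 \<in> T" "w = t1 \<otimes> t2 \<otimes> t3"
proof -
  obtain ts where ts: "set ts \<subseteq> T" "list_prod W ts = w" "length ts = 3"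
    using refl.minimal_word[OF assms(1)] assms(2) by metis
  then obtain t1 t2 t3 where t: "ts = [t1, t2, t3]" "t1 \<in> T" "t2 \<in> T" "t3 \<in> T"
    by (auto simp: length_Suc_conv numeral_3_eq_3)
  then have "w = t1 \<otimes> t2 \<otimes> t3"
    using ts(2) by (simp add: m_assoc)
  with t show thesis
    by (intro that)
qed

text \<open>A letter of a shortest word can be moved to the front at the cost of conjugating the letters before
  it, which keeps the word length.\<close>

lemma factors_below_2:
  assumes T: "t1 \<in> T" "t2 \<in> T" and "rlen (t1 \<otimes> t2) = 2"
  shows "t1 \<preceq> t1 \<otimes> t2" "t2 \<preceq> t1 \<otimes> t2"
  using assms rlen_reflection[OF reflection_conj_reflection[OF T(2,1)]]
  by (auto intro!: reflection_abs_leI simp: rlen_reflection m_assoc)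

lemma factors_below_3:
  assumes T: "t1 \<in> T" "t2 \<in> T" "t3 \<in> T" and w: "rlen (t1 \<otimes> t2 \<otimes> t3) = 3"
  shows "t1 \<preceq> t1 \<otimes> t2 \<otimes> t3" "t2 \<preceq> t1 \<otimes> t2 \<otimes> t3" "t3 \<preceq> t1 \<otimes> t2 \<otimes> t3"
proof -
  have le2: "rlen (t \<otimes> u) \<le> 2" if "t \<in> T" "u \<in> T" for t u
    using refl.len_mult[of t u] that by (simp add: rlen_reflection)
  have "rlen (t1 \<otimes> (t1 \<otimes> t2 \<otimes> t3)) \<le> 2"
    using T le2 by (simp add: m_assoc)
  then show "t1 \<preceq> t1 \<otimes> t2 \<otimes> t3"
    using T w by (intro reflection_abs_leI) auto
  have "t2 \<otimes> (t1 \<otimes> t2 \<otimes> t3) = (t2 \<otimes> t1 \<otimes> t2) \<otimes> t3"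
    using T by (simp add: m_assoc)
  then have "rlen (t2 \<otimes> (t1 \<otimes> t2 \<otimes> t3)) \<le> 2"
    using T le2[OF reflection_conj_reflection[OF T(2,1)] T(3)] by simp
  then show "t2 \<preceq> t1 \<otimes> t2 \<otimes> t3"
    using T w by (intro reflection_abs_leI) auto
  have "t3 \<otimes> (t1 \<otimes> t2 \<otimes> t3) = (t3 \<otimes> t1 \<otimes> t3) \<otimes> (t3 \<otimes> t2 \<otimes> t3)"
    using T by (simp add: m_assoc)
  then have "rlen (t3 \<otimes> (t1 \<otimes> t2 \<otimes> t3)) \<le> 2"
    using le2[OF reflection_conj_reflection[OF T(3,1)] reflection_conj_reflection[OF T(3,2)]]
    by simp
  then show "t3 \<preceq> t1 \<otimes> t2 \<otimes> t3"
    using T w by (intro reflection_abs_leI) auto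
qed

abbreviation below :: "'a \<Rightarrow> 'a set" where
  "below \<equiv> refl_below W S"

abbreviation AM :: "'a \<Rightarrow> ('a \<Rightarrow>\<^sub>0 real) set" where
  "AM \<equiv> abs_moved_space W S"

lemma root_in_AM: "t \<in> T \<Longrightarrow> t \<preceq> x \<Longrightarrow> \<rho> t \<in> AM x"
  unfolding abs_moved_space_def by (rule span_base) (simp add: refl_below_def)

lemma AM_mono_below: "below x \<subseteq> below y \<Longrightarrow> AM x \<subseteq> AM y"
  unfolding abs_moved_space_def by (intro span_mono image_mono)

lemma AM_minimal: "(\<And>t. t \<in> T \<Longrightarrow> t \<preceq> x \<Longrightarrow> \<rho> t \<in> AM y) \<Longrightarrow> AM x \<subseteq> AM y"
  unfolding abs_moved_space_def[of _ _ x]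
  by (intro span_minimal) (auto simp: abs_moved_space_def refl_below_def)

lemma AM_rank_0: "AM \<one> = {0}"
proof -
  have "below \<one> = {}"
    by (auto simp: refl_below_def abs_le_iff rlen_reflection)
  then show ?thesis
    by (simp add: abs_moved_space_def)
qed

lemma AM_rank_1:
  assumes "t \<in> T"
  shows "AM t = span {\<rho> t}"
proof -
  have "below t = {t}"
    using assms abs_le_eqI[of _ t] by (auto simp: refl_below_def rlen_reflection abs_le_refl)
  then show ?thesis
    by (simp add: abs_moved_space_def)
qed

lemma AM_rank_2:
  assumes T: "t1 \<in> T" "t2 \<in> T" and w: "rlen (t1 \<otimes> t2) = 2"
  shows "AM (t1 \<otimes> t2) = span {\<rho> t1, \<rho> t2}"
proof
  show "span {\<rho> t1, \<rho> t2} \<subseteq> AM (t1 \<otimes> t2)"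
    using factors_below_2[OF assms] root_in_AM T
    by (intro span_minimal) (auto simp: abs_moved_space_def)
  show "AM (t1 \<otimes> t2) \<subseteq> span {\<rho> t1, \<rho> t2}"
    unfolding abs_moved_space_def
  proof (intro span_minimal subspace_span image_subsetI)
    fix t assume "t \<in> below (t1 \<otimes> t2)"
    then have t: "t \<in> T" "t \<preceq> t1 \<otimes> t2"
      by (simp_all add: refl_below_def)
    define u where "u = t \<otimes> (t1 \<otimes> t2)"
    have "rlen u = 1"
      using reflection_abs_leD[OF t] w by (simp add: u_def)
    then have u: "u \<in> T"
      using t T by (intro refl.len_1_gen) (auto simp: u_def)
    have prod: "t \<otimes> u = t1 \<otimes> t2"
      using t T by (simp add: u_def)
    moreover have "t \<noteq> u"
    proof
      assume "t = u"
      then have "t1 \<otimes> t2 = \<one>"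
        using prod u by simp
      with w show False
        by simp
    qed
    ultimately show "\<rho> t \<in> span {\<rho> t1, \<rho> t2}"
      using T t u by (intro root_of_factor_in_plane[of t1 t2 t u])
  qed
qed

text \<open>For \<open>w = t1 t2\<close> the product \<open>t t1 t2\<close> of coplanar reflections is a reflection.\<close>

lemma reflection_below_of_root_in_AM:
  assumes "w \<in> carrier W" "rlen w = 2" "t \<in> T" "\<rho> t \<in> AM w"
  shows "t \<preceq> w"
proof -
  obtain t1 t2 where t: "t1 \<in> T" "t2 \<in> T" "w = t1 \<otimes> t2"
    using assms(1,2) by (rule rlen_2E)
  have "\<rho> t \<in> span {\<rho> t1, \<rho> t2}"
    using AM_rank_2 t assms by simp
  then have "t \<otimes> t1 \<otimes> t2 \<in> T"
    using t assms(3) by (intro coplanar_triple_reflection(1)[of _ _ _ "\<rho> t1" "\<rho> t2"])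
      (auto intro: span_base)
  then have "rlen (t \<otimes> w) = 1"
    using t assms(3) by (simp add: rlen_reflection m_assoc)
  then show ?thesis
    using assms by (intro reflection_abs_leI) auto
qed

text \<open>Write \<open>c = x r = y r'\<close> with reflections \<open>r\<close> and \<open>r'\<close>, so that \<open>r r' = x\<inverse> y\<close>. The right-hand side is a
  product of four reflections with roots in the plane \<open>AM y\<close>, hence a product of two such
  reflections. If \<open>r \<noteq> r'\<close>, then \<open>\<rho> r\<close> lies in the plane as well, and \<open>c = x r\<close> is a product of
  three coplanar reflections, that is, a reflection.\<close>

lemma rank_2_eq_of_AM_subset:
  assumes c: "c \<in> carrier W" "rlen c = 3"
    and x: "x \<in> carrier W" "rlen x = 2" "x \<preceq> c"
    and y: "y \<in> carrier W" "rlen y = 2" "y \<preceq> c"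
    and sub: "AM x \<subseteq> AM y"
  shows "x = y"
proof (rule ccontr)
  assume "x \<noteq> y"
  obtain t1 t2 where t: "t1 \<in> T" "t2 \<in> T" "x = t1 \<otimes> t2"
    using x(1,2) by (rule rlen_2E)
  obtain u1 u2 where u: "u1 \<in> T" "u2 \<in> T" "y = u1 \<otimes> u2"
    using y(1,2) by (rule rlen_2E)
  define P where "P = span {\<rho> u1, \<rho> u2}"
  have "span {\<rho> t1, \<rho> t2} \<subseteq> P"
    using AM_rank_2 t u x y sub by (simp add: P_def)
  then have tP: "\<rho> t1 \<in> P" "\<rho> t2 \<in> P"
    by (auto intro: span_base)
  have uP: "\<rho> u1 \<in> P" "\<rho> u2 \<in> P"
    by (auto simp: P_def intro: span_base)
  define r r' where "r = inv x \<otimes> c" and "r' = inv y \<otimes> c"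
  have "rlen r = 1" "rlen r' = 1"
    using x y c by (simp_all add: abs_le_iff r_def r'_def)
  then have rT: "r \<in> T" "r' \<in> T"
    using x y c by (auto intro!: refl.len_1_gen simp: r_def r'_def)
  have cx: "c = x \<otimes> r" and cy: "c = y \<otimes> r'"
    using x y c by (simp_all add: r_def r'_def flip: m_assoc)
  have "r \<noteq> r'"
    using cx cy x y rT \<open>x \<noteq> y\<close> by (metis right_cancel reflection_carrier)
  define q where "q = t2 \<otimes> t1 \<otimes> u1"
  have q: "q \<in> T" "\<rho> q \<in> P"
    using t u tP uP coplanar_triple_reflection[of t2 t1 u1 "\<rho> u1" "\<rho> u2"]
    by (auto simp: q_def P_def)
  have x_rr': "x \<otimes> (r \<otimes> r') = y"
    using cx cy x y rT by (metis m_assoc r_one reflection_carrier reflection_square)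
  have "r \<otimes> r' = t2 \<otimes> (t1 \<otimes> (x \<otimes> (r \<otimes> r')))"
    using t rT by (simp add: m_assoc)
  also have "\<dots> = q \<otimes> u2"
    unfolding x_rr' using t u by (simp add: q_def m_assoc)
  finally have "r \<otimes> r' = q \<otimes> u2" .
  then have "\<rho> r \<in> span {\<rho> q, \<rho> u2}"
    using q u rT \<open>r \<noteq> r'\<close> by (intro root_of_factor_in_plane[of q u2 r r'])
  moreover have "span {\<rho> q, \<rho> u2} \<subseteq> P"
    unfolding P_def using q(2) uP by (intro span_minimal) (auto simp: P_def)
  ultimately have "\<rho> r \<in> P"
    by blast
  then have "t1 \<otimes> t2 \<otimes> r \<in> T"
    using t rT tP by (intro coplanar_triple_reflection(1)[of _ _ _ "\<rho> u1" "\<rho> u2"])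
      (auto simp: P_def)
  then have "rlen c = 1"
    using cx t by (simp add: rlen_reflection)
  with c show False
    by simp
qed

text \<open>The length of \<open>x\<close> bounds from below what \<open>AM x\<close> must contain: the root of a reflection, two
  independent roots, or the roots of three reflections with product \<open>x\<close>. In the last case those
  cannot lie in a plane, since \<open>x\<close> would be a reflection; and \<open>AM y\<close> lies in a plane.\<close>

lemma rank_le_of_AM_subset:
  assumes x: "x \<in> carrier W" and y: "y \<in> carrier W"
    and "rlen x \<le> 3" "AM x \<subseteq> AM y" "rlen y \<le> 2"
  shows "rlen x \<le> rlen y"
proof -
  consider "rlen x \<le> rlen y" | "rlen x = 1" "rlen y = 0" | "rlen x = 2" "rlen y \<le> 1"
    | "rlen x = 3" "rlen y \<le> 2"
    using assms by linarith
  then show ?thesis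
  proof cases
    case 2
    then have "x \<in> T"
      using x by (intro refl.len_1_gen)
    moreover from this 2 have "\<rho> x \<in> {0}"
      using assms root_in_AM[of x x] abs_le_refl[OF x] AM_rank_0 refl.len_0_iff[OF y] by auto
    ultimately show ?thesis
      using refl_root_norm[of x] by simp
  next
    case 3
    obtain t1 t2 where t: "t1 \<in> T" "t2 \<in> T" "x = t1 \<otimes> t2" "t1 \<noteq> t2"
      using x 3(1) by (rule rlen_2E)
    have in_y: "\<rho> t1 \<in> AM y" "\<rho> t2 \<in> AM y"
      using t 3(1) assms(4) factors_below_2[of t1 t2] root_in_AM by auto
    obtain b where b: "AM y \<subseteq> span {b}"
    proof (cases "rlen y = 0")
      case True
      then show ?thesis
        using that[of 0] AM_rank_0 refl.len_0_iff[OF y] by auto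
    next
      case False
      with 3(2) have "y \<in> T"
        using y by (intro refl.len_1_gen) auto
      then show ?thesis
        using that AM_rank_1 by blast
    qed
    have "{\<rho> t1, \<rho> t2} \<subseteq> span {b}"
      using in_y b by blast
    then have "card {\<rho> t1, \<rho> t2} \<le> card {b}"
      using independent_span_bound[OF _ refl_roots_independent(1)[OF t(1,2,4)]] by blast
    with refl_roots_independent(2)[OF t(1,2,4)] show ?thesis
      by simp
  next
    case 4
    obtain t1 t2 t3 where t: "t1 \<in> T" "t2 \<in> T" "t3 \<in> T" "x = t1 \<otimes> t2 \<otimes> t3"
      using x 4(1) by (rule rlen_3E)
    have in_y: "\<rho> t1 \<in> AM y" "\<rho> t2 \<in> AM y" "\<rho> t3 \<in> AM y"
      using t 4(1) assms(4) factors_below_3[of t1 t2 t3] root_in_AM by auto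
    obtain a b where "AM y \<subseteq> span {a, b}"
    proof -
      consider "rlen y = 0" | "rlen y = 1" | "rlen y = 2"
        using 4(2) by linarith
      then show ?thesis
      proof cases
        case 1
        then show ?thesis
          using that[of 0 0] AM_rank_0 refl.len_0_iff[OF y] by auto
      next
        case 2
        then have "y \<in> T"
          using y by (intro refl.len_1_gen)
        then show ?thesis
          using that[of "\<rho> y" "\<rho> y"] AM_rank_1 by simp
      next
        case 3
        with y obtain u1 u2 where "u1 \<in> T" "u2 \<in> T" "y = u1 \<otimes> u2"
          using rlen_2E by metis
        then show ?thesis
          using that[of "\<rho> u1" "\<rho> u2"] AM_rank_2 3 by simp
      qed
    qed
    then have "x \<in> T"
      using coplanar_triple_reflection(1)[OF t(1-3)] in_y t(4) by blast
    then show ?thesis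
      using 4(1) by (simp add: rlen_reflection)
  qed
qed

theorem abs_le_of_AM_subset:
  assumes c: "c \<in> carrier W" "rlen c \<le> 3"
    and x: "x \<in> carrier W" "x \<preceq> c" and y: "y \<in> carrier W" "y \<preceq> c"
    and sub: "AM x \<subseteq> AM y"
  shows "x \<preceq> y"
proof (cases "rlen c \<le> rlen y")
  case True
  then have "y = c"
    using abs_le_eqI[OF y(1) c(1) y(2)] by simp
  with x show ?thesis
    by simp
next
  case False
  have le: "rlen x \<le> rlen y"
    using c x y sub False abs_le_rlen[OF x(2)] by (intro rank_le_of_AM_subset) auto
  consider "rlen x = 0" | "rlen x = 1" "rlen y = 1" | "rlen x = 1" "rlen y = 2"
    | "rlen x = 2" "rlen y = 2" "rlen c = 3"
    using le c(2) False by linarith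
  then show ?thesis
  proof cases
    case 1
    then show ?thesis
      using x y abs_le_one refl.len_0_iff by simp
  next
    case 2
    then have T: "x \<in> T" "y \<in> T"
      using x y by (auto intro: refl.len_1_gen)
    then have "\<rho> x \<in> span {\<rho> y}"
      using sub root_in_AM[of x x] abs_le_refl[OF x(1)] by (auto simp: AM_rank_1)
    then have "x = y"
      using refl_root_proportional[OF T] by (auto simp: span_singleton)
    then show ?thesis
      using abs_le_refl x by simp
  next
    case 3
    then have "x \<in> T"
      using x by (auto intro: refl.len_1_gen)
    then show ?thesis
      using 3 y sub root_in_AM[of x x] abs_le_refl[OF x(1)]
      by (intro reflection_below_of_root_in_AM) auto
  next
    case 4
    then show ?thesis
      using rank_2_eq_of_AM_subset[OF c(1) 4(3) x(1) 4(1) x(2) y(1) 4(2) y(2) sub]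
        abs_le_refl x by simp
  qed
qed

text \<open>Each generator \<open>t\<close> moves every vector by a multiple of \<open>\<rho> t\<close>, and displacements add up along
  products.\<close>

lemma subgroup_moves_within_AM:
  assumes "g \<in> refl_below_subgroup W S y"
  shows "act g v - v \<in> AM y"
proof -
  have step: "act t v - v \<in> AM y" if "t \<in> below y" for t v
  proof -
    have "t \<in> T" "\<rho> t \<in> AM y"
      using that root_in_AM by (auto simp: refl_below_def)
    then have "- ((2 * B (\<rho> t) v) *\<^sub>R \<rho> t) \<in> AM y"
      unfolding abs_moved_space_def by (intro span_neg span_scale)
    then show ?thesis
      using \<open>t \<in> T\<close> by (simp add: act_reflection geom_reflection_def)
  qed
  have below_carrier: "below y \<subseteq> carrier W"
    using reflections_closed by (auto simp: refl_below_def)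
  show ?thesis
    using assms unfolding refl_below_subgroup_def
  proof (induction arbitrary: v rule: generate.induct)
    case one
    show ?case
      by (simp add: abs_moved_space_def span_zero)
  next
    case (incl t)
    then show ?case
      by (rule step)
  next
    case (inv t)
    then have "inv t = t"
      by (simp add: refl_below_def)
    then show ?case
      using step[OF inv] by simp
  next
    case (eng g h)
    have "act (g \<otimes> h) v - v = (act g (act h v) - act h v) + (act h v - v)"
      using generate_in_carrier[OF below_carrier] eng.hyps by (simp add: aff_act_mult)
    then show ?case
      using eng.IH unfolding abs_moved_space_def by (metis span_add)
  qed
qed

lemma AM_subset_of_subgroup_subset:
  assumes "refl_below_subgroup W S x \<subseteq> refl_below_subgroup W S y"
  shows "AM x \<subseteq> AM y"
proof (rule AM_minimal)
  fix t assume t: "t \<in> T" "t \<preceq> x"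
  then have "t \<in> refl_below_subgroup W S y"
    using assms by (auto simp: refl_below_subgroup_def refl_below_def intro: generate.incl)
  then have "act t (\<rho> t) - \<rho> t \<in> AM y"
    by (rule subgroup_moves_within_AM)
  moreover have "act t (\<rho> t) - \<rho> t = (- 2) *\<^sub>R \<rho> t"
    using t by (simp add: act_reflection geom_reflection_def)
  ultimately have "(- 2) *\<^sub>R \<rho> t \<in> AM y"
    by metis
  then have "(- 1 / 2) *\<^sub>R ((- 2) *\<^sub>R \<rho> t) \<in> AM y"
    unfolding abs_moved_space_def by (rule span_scale)
  then show "\<rho> t \<in> AM y"
    by simp
qed

lemma below_mono:
  assumes "x \<in> carrier W" "y \<in> carrier W" "x \<preceq> y"
  shows "below x \<subseteq> below y"
  using assms abs_le_trans[of _ x y] by (auto simp: refl_below_def)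

lemma below_subset_imp_subgroup_subset:
  "below x \<subseteq> below y \<Longrightarrow> refl_below_subgroup W S x \<subseteq> refl_below_subgroup W S y"
  unfolding refl_below_subgroup_def by (rule mono_generate)

lemma abs_poset_partial_order: "weak_partial_order (abs_poset W S c)"
  by unfold_locales
    (auto simp: abs_poset_def abs_interval_def intro: abs_le_refl abs_le_antisym abs_le_trans)

lemma incl_poset_partial_order: "weak_partial_order (incl_poset A)"
  by unfold_locales (auto simp: incl_poset_def)

lemma poset_iso_onto_imageI:
  assumes "\<And>x. x \<in> abs_interval W S c \<Longrightarrow> F x \<in> A"
    and iff: "\<And>x y. x \<in> abs_interval W S c \<Longrightarrow> y \<in> abs_interval W S c \<Longrightarrow>
      F x \<subseteq> F y \<longleftrightarrow> x \<preceq> y"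
  shows "poset_iso_onto_image (abs_poset W S c) (incl_poset A) F"
proof -
  have "inj_on F (abs_interval W S c)"
  proof (rule inj_onI)
    fix x y assume "x \<in> abs_interval W S c" "y \<in> abs_interval W S c" "F x = F y"
    then show "x = y"
      using iff[of x y] iff[of y x] abs_le_antisym[of x y] by (simp add: abs_interval_def)
  qed
  then show ?thesis
    using assms abs_poset_partial_order[of c] incl_poset_partial_order[of A]
    by (auto simp: poset_iso_onto_image_def order_emb_def abs_poset_def incl_poset_def)
qed

theorem interval_embeddings:
  assumes c: "c \<in> carrier W" "rlen c \<le> 3"
  shows "poset_iso_onto_image (abs_poset W S c) (incl_poset (subspaces (geom_space S))) AM"
    and "poset_iso_onto_image (abs_poset W S c) (incl_poset (reflection_subgroups W S))
      (refl_below_subgroup W S)"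
    and "poset_iso_onto_image (abs_poset W S c) (incl_poset (Pow T)) below"
proof -
  have AM_le: "x \<preceq> y"
    if "x \<in> abs_interval W S c" "y \<in> abs_interval W S c" "AM x \<subseteq> AM y" for x y
    using that abs_le_of_AM_subset[OF c] by (simp add: abs_interval_def)
  have le_below: "below x \<subseteq> below y"
    if "x \<in> abs_interval W S c" "y \<in> abs_interval W S c" "x \<preceq> y" for x y
    using that below_mono by (simp add: abs_interval_def)
  have "AM x \<in> subspaces (geom_space S)" for x
  proof -
    have "AM x \<subseteq> geom_space S"
      unfolding abs_moved_space_def using subspace_geom_space refl_root_in_space
      by (intro span_minimal) (auto simp: refl_below_def)
    then show ?thesis
      by (simp add: subspaces_def abs_moved_space_def)
  qed
  then show "poset_iso_onto_image (abs_poset W S c) (incl_poset (subspaces (geom_space S))) AM"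
  proof (rule poset_iso_onto_imageI)
    show "AM x \<subseteq> AM y \<longleftrightarrow> x \<preceq> y"
      if "x \<in> abs_interval W S c" "y \<in> abs_interval W S c" for x y
      using AM_le[OF that] le_below[OF that] AM_mono_below[of x y] by blast
  qed
  have "refl_below_subgroup W S x \<in> reflection_subgroups W S" for x
    by (auto simp: refl_below_subgroup_def reflection_subgroups_def refl_below_def)
  then show "poset_iso_onto_image (abs_poset W S c) (incl_poset (reflection_subgroups W S))
      (refl_below_subgroup W S)"
  proof (rule poset_iso_onto_imageI)
    show "refl_below_subgroup W S x \<subseteq> refl_below_subgroup W S y \<longleftrightarrow> x \<preceq> y"
      if "x \<in> abs_interval W S c" "y \<in> abs_interval W S c" for x y
      using AM_le[OF that] le_below[OF that] AM_subset_of_subgroup_subset[of x y]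
        below_subset_imp_subgroup_subset[of x y] by blast
  qed
  have "below x \<in> Pow T" for x
    by (auto simp: refl_below_def)
  then show "poset_iso_onto_image (abs_poset W S c) (incl_poset (Pow T)) below"
  proof (rule poset_iso_onto_imageI)
    show "below x \<subseteq> below y \<longleftrightarrow> x \<preceq> y"
      if "x \<in> abs_interval W S c" "y \<in> abs_interval W S c" for x y
      using AM_le[OF that] le_below[OF that] AM_mono_below[of x y] by blast
  qed
qed

end


theorem proposition1p2:
  fixes W :: "('a, 'b) monoid_scheme" and S :: "'a set" and c :: 'a
  assumes "coxeter_system W S" and "card S = 3" and "coxeter_element W S c"
  shows "poset_iso_onto_image (abs_poset W S c) (incl_poset (subspaces (geom_space S)))
           (abs_moved_space W S)
       \<and> poset_iso_onto_image (abs_poset W S c) (incl_poset (reflection_subgroups W S))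
           (refl_below_subgroup W S)
       \<and> poset_iso_onto_image (abs_poset W S c) (incl_poset (Pow (reflections W S)))
           (refl_below W S)"
proof -
  interpret group W
    using assms(1) by (simp add: coxeter_system_def)
  interpret finite_rank_coxeter W S
    using assms(1,2) by unfold_locales (auto intro: card_ge_0_finite)
  obtain ss where ss: "distinct ss" "set ss = S" "list_prod W ss = c"
    using assms(3) by (auto simp: coxeter_element_def)
  have "c \<in> carrier W"
    using list_prod_closed[of ss] ss S_closed by auto
  moreover have "word_length W (reflections W S) c \<le> 3"
    using refl.len_le[of ss] ss S_subset_reflections distinct_card[OF ss(1)] assms(2) by auto
  ultimately show ?thesis
    using interval_embeddings by blast
qed

end
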